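(* Let $k\geq 3$ and let $H$ be a $k$-graph. Then there exists an integer $n_0=n_0(H)$ such that for all $n\geq n_0$ with $n\equiv 1\pmod{k-1}$, $$R(P^{(k)}_{n,1},H)\leq (\chi(H)-1)(n-1)+\max\{\tau(k-1,\sigma(H))-2k+3,\ \sigma(H)\}.$$
   Context: A $k$-graph is a $k$-uniform hypergraph. $R(G,H)$ is the least $N$ such that every red/blue colouring of the edges of $K^{(k)}_N$ contains a red copy of $G$ or a blue copy of $H$. A proper colouring is a vertex colouring with no monochromatic edge; $\chi(H)$ is the least number of colours of a proper colouring, and $\sigma(H)$ is the smallest possible size of a colour class in a proper colouring of $H$ with $\chi(H)$ colours. The loose path $P^{(k)}_{n,1}$ ($n=q(k-1)+1$) has vertices $v_1,\dots,v_n$ and edges $\{v_{(i-1)(k-1)+1},\dots,v_{i(k-1)+1}\}$, $i\in[q]$. For integers $j,\alpha\ge1$, $\tau(j,\alpha)$ is the largest $N$ such that some $j$-uniform hypergraph on $N$ vertices has independence number less than $\alpha$ and no two edges meeting in exactly one vertex. *)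

theory Defs
  imports Main
begin

definition kgraph :: "nat \<Rightarrow> 'a set \<Rightarrow> 'a set set \<Rightarrow> bool" where
  "kgraph k V E \<longleftrightarrow> finite V \<and> (\<forall>e\<in>E. e \<subseteq> V \<and> card e = k)"

definition proper_colouring :: "'a set \<Rightarrow> 'a set set \<Rightarrow> ('a \<Rightarrow> nat) \<Rightarrow> nat \<Rightarrow> bool" where
  "proper_colouring V E c m \<longleftrightarrow>
     (\<forall>v\<in>V. c v < m) \<and> (\<forall>e\<in>E. \<not> (\<exists>i. \<forall>v\<in>e. c v = i))"

definition chi :: "'a set \<Rightarrow> 'a set set \<Rightarrow> nat" where
  "chi V E = (LEAST m. \<exists>c. proper_colouring V E c m)"

definition sigma :: "'a set \<Rightarrow> 'a set set \<Rightarrow> nat" where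
  "sigma V E = (LEAST s. \<exists>c. proper_colouring V E c (chi V E) \<and>
       s = Min ((\<lambda>i. card {v\<in>V. c v = i}) ` {..<chi V E}))"

definition has_copy :: "nat \<Rightarrow> (nat set \<Rightarrow> bool) \<Rightarrow> bool \<Rightarrow> 'a set \<Rightarrow> 'a set set \<Rightarrow> bool" where
  "has_copy N col b V E \<longleftrightarrow>
     (\<exists>f. inj_on f V \<and> f ` V \<subseteq> {..<N} \<and> (\<forall>e\<in>E. col (f ` e) = b))"

text \<open>Ramsey number R(G,H) for k-graphs; colour True = red, False = blue.
  Only values of col on k-subsets of {..<N} matter.\<close>
definition ramsey :: "'a set \<Rightarrow> 'a set set \<Rightarrow> 'b set \<Rightarrow> 'b set set \<Rightarrow> nat" where
  "ramsey VG EG VH EH = (LEAST N. \<forall>col :: nat set \<Rightarrow> bool.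
       has_copy N col True VG EG \<or> has_copy N col False VH EH)"

definition loose_path_vertices :: "nat \<Rightarrow> nat set" where
  "loose_path_vertices n = {1..n}"

definition loose_path_edges :: "nat \<Rightarrow> nat \<Rightarrow> nat set set" where
  "loose_path_edges k n =
     {{(i - 1) * (k - 1) + 1 .. i * (k - 1) + 1} | i. 1 \<le> i \<and> i \<le> (n - 1) div (k - 1)}"

definition indep_num :: "'a set \<Rightarrow> 'a set set \<Rightarrow> nat" where
  "indep_num V E = Max {card S | S. S \<subseteq> V \<and> (\<forall>e\<in>E. \<not> e \<subseteq> S)}"

definition tau :: "nat \<Rightarrow> nat \<Rightarrow> nat" where
  "tau j \<alpha> = (GREATEST N. \<exists>E :: nat set set.
       (\<forall>e\<in>E. e \<subseteq> {..<N} \<and> card e = j) \<and>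
       indep_num {..<N} E < \<alpha> \<and>
       (\<forall>e1\<in>E. \<forall>e2\<in>E. e1 \<noteq> e2 \<longrightarrow> card (e1 \<inter> e2) \<noteq> 1))"

end

theory Submission
  imports Defs "HOL-Library.Ramsey"
begin

text \<open>
  Let \<open>s = chi - 1\<close> and \<open>n = q (k - 1) + 1\<close>, and suppose there is neither a red loose path with
  \<open>q\<close> edges nor a blue copy of \<open>H\<close>. By Ramsey's theorem every large vertex set contains a red clique,
  and a loose path runs freely through a red clique. Growing a red path as long as possible between
  two clique tails yields a clique tail \<open>S\<close> and a set \<open>T\<close>, consisting of all but about \<open>n\<close> vertices,
  such that all edges meeting both are blue. Iterating in \<open>T\<close> gives either
  \<open>chi\<close> large sets with only blue edges across, hence a blue \<open>H\<close>, or \<open>s\<close> disjoint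
  ``necklaces'' (a large red clique \<open>R\<close> together with a red path that starts and ends in \<open>R\<close>) that
  cover all but boundedly many vertices.

  Take such necklaces \<open>A i\<close> with the set \<open>X\<close> of uncovered vertices as small as possible. A red edge
  between two cliques would join two necklaces to a path that is too long. A red edge within \<open>X\<close> and
  one clique that has two vertices in the clique would be absorbed by the necklace. So the only red
  edges left between \<open>X\<close> and a clique are \<open>Y \<union> {v}\<close> with \<open>Y\<close> a \<open>(k-1)\<close>-subset of \<open>X\<close>; two
  such sets \<open>Y\<close> never meet in exactly one vertex, since that would again give an absorption or a
  link. A \<open>sigma\<close>-subset of \<open>X\<close> that contains no such \<open>Y\<close> would give a blue \<open>H\<close>. If one necklace
  has two disjoint sets \<open>Y\<close>, they prolong its path at both ends, so \<open>\<bar>A i\<bar> \<le> n - 1 - 2 (k - 1)\<close>, while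
  \<open>\<bar>X\<bar> \<le> tau\<close>. Otherwise all the sets \<open>Y\<close> of necklace \<open>i\<close> are hit by \<open>k - 2\<close> vertices,
  and any one of them prolongs the path at one end, so \<open>\<bar>A i\<bar> \<le> n - 1 - (k - 1)\<close>.
  Either way \<open>\<bar>X\<bar> + (\<Sum>i. \<bar>A i\<bar>)\<close> is smaller than the assumed number of vertices.
\<close>

locale red_hypergraph =
  fixes k :: nat and red :: "'v set \<Rightarrow> bool"
  assumes k_ge_3: "k \<ge> 3"
begin

subsection \<open>Loose paths in red cliques\<close>

text \<open>Only the two ends, the vertex set and the number of edges are recorded. Any vertex of
  the last edge other than \<open>b\<close> may serve as the new end, and this freedom allows a path
  to be steered through a clique.\<close>

inductive lpath :: "'v \<Rightarrow> 'v set \<Rightarrow> 'v \<Rightarrow> nat \<Rightarrow> bool" where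
  lpath_Nil: "lpath a {a} a 0"
| lpath_snoc: "lpath a P b m \<Longrightarrow> red e \<Longrightarrow> card e = k \<Longrightarrow> e \<inter> P = {b} \<Longrightarrow> c \<in> e \<Longrightarrow> c \<noteq> b
    \<Longrightarrow> lpath a (P \<union> e) c (Suc m)"

lemma finite_edge: "card e = k \<Longrightarrow> finite e"
  using k_ge_3 by (metis card.infinite not_numeral_le_zero)

lemma lpath_props:
  "lpath a P b m \<Longrightarrow> finite P \<and> a \<in> P \<and> b \<in> P \<and> card P = m * (k - 1) + 1"
proof (induction rule: lpath.induct)
  case (lpath_snoc a P b m e c)
  then have "finite e" using finite_edge by blast
  with lpath_snoc card_Un_Int[of P e] k_ge_3 show ?case by (auto simp: Int_commute)
qed simp

lemma lpath_edge:
  assumes "red e" "card e = k" "a \<in> e" "c \<in> e" "a \<noteq> c"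
  shows "lpath a e c 1"
proof -
  have "lpath a ({a} \<union> e) c (Suc 0)"
    using assms by (intro lpath_snoc[OF lpath_Nil]) auto
  moreover have "{a} \<union> e = e" using assms by auto
  ultimately show ?thesis by simp
qed

lemma lpath_append:
  assumes "lpath b P' c m'" "lpath a P b m" "P \<inter> P' = {b}"
  shows "lpath a (P \<union> P') c (m + m')"
  using assms
proof (induction arbitrary: m rule: lpath.induct)
  case (lpath_Nil b)
  then have "P \<union> {b} = P" by auto
  with lpath_Nil show ?case by simp
next
  case (lpath_snoc b P' d m' e c)
  have "P \<inter> P' = {b}" using lpath_snoc lpath_props[of b P' d m'] by auto
  with lpath_snoc have *: "lpath a (P \<union> P') d (m + m')" by blast
  have "e \<inter> (P \<union> P') = {d}"
    using lpath_snoc lpath_props[of b P' d m'] by auto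
  from lpath.lpath_snoc[OF * lpath_snoc(2,3) this lpath_snoc(5,6)]
  show ?case by (simp add: Un_assoc)
qed

text \<open>The last edge, read backwards, is a one-edge path, and the reversed rest is appended to
  it.\<close>

lemma lpath_rev: "lpath a P b m \<Longrightarrow> lpath b P a m"
proof (induction rule: lpath.induct)
  case (lpath_snoc a P b m e c)
  have "lpath c e b 1" using lpath_snoc by (intro lpath_edge) auto
  from lpath_append[OF lpath_snoc(7) this] lpath_snoc(4) show ?case
    by (simp add: Un_commute)
qed (rule lpath_Nil)

lemma lpath_prefix:
  "lpath a P b m \<Longrightarrow> j \<le> m \<Longrightarrow> \<exists>P' b'. P' \<subseteq> P \<and> lpath a P' b' j"
proof (induction rule: lpath.induct)
  case (lpath_snoc a P b m e c)
  show ?case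
  proof (cases "j = Suc m")
    case True
    then show ?thesis
      using lpath.lpath_snoc[OF lpath_snoc.hyps] by blast
  next
    case False
    then have "j \<le> m" using lpath_snoc.prems by simp
    then obtain P' b' where "P' \<subseteq> P" "lpath a P' b' j" using lpath_snoc.IH by blast
    then show ?thesis by blast
  qed
qed (use lpath_Nil in auto)

text \<open>Passes from the inductive notion to the numbering of vertices in
  \<open>loose_path_edges\<close>, so that a red path becomes a copy of the loose path.\<close>

lemma lpath_enumeration:
  assumes "lpath a P b m"
  obtains f :: "nat \<Rightarrow> 'v" where "bij_betw f {1..m * (k - 1) + 1} P" "f (m * (k - 1) + 1) = b"
    "\<And>i. 1 \<le> i \<Longrightarrow> i \<le> m \<Longrightarrow> red (f ` {(i - 1) * (k - 1) + 1 .. i * (k - 1) + 1})"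
  using assms
proof (induction arbitrary: thesis rule: lpath.induct)
  case (lpath_Nil a)
  show ?case by (rule lpath_Nil[of "\<lambda>_. a"]) (auto simp: bij_betw_def)
next
  case (lpath_snoc a P b m e c)
  obtain f where f: "bij_betw f {1..m * (k - 1) + 1} P" "f (m * (k - 1) + 1) = b"
    "\<And>i. 1 \<le> i \<Longrightarrow> i \<le> m \<Longrightarrow> red (f ` {(i - 1) * (k - 1) + 1 .. i * (k - 1) + 1})"
    using lpath_snoc.IH by blast
  \<comment> \<open>\<open>s\<close> and \<open>t\<close> are the positions of the ends
    \<open>b\<close> and \<open>c\<close> of the last edge; the \<open>k - 2\<close> vertices of
    \<open>e\<close> between them may be numbered in any order.\<close>
  define s t where "s = m * (k - 1) + 1" and "t = Suc m * (k - 1) + 1"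
  have st: "s + (k - 1) = t" by (simp add: s_def t_def)
  have fin: "finite e" using finite_edge lpath_snoc by blast
  have "card {s + 1..t - 1} = card (e - {b, c})"
    using lpath_snoc fin st k_ge_3 by (subst card_Diff_subset) auto
  then obtain g where g: "bij_betw g {s + 1..t - 1} (e - {b, c})"
    using finite_same_card_bij fin by blast
  define h where "h x = (if x \<le> s then f x else if x < t then g x else c)" for x
  have h1: "bij_betw h {1..s} P"
    by (rule iffD1[OF bij_betw_cong f(1)[folded s_def]]) (simp add: h_def)
  have h2: "bij_betw h {s + 1..t - 1} (e - {b, c})"
    using g by (rule iffD1[OF bij_betw_cong, rotated]) (auto simp: h_def)
  have h3: "bij_betw h {t} {c}" using st k_ge_3 by (auto simp: h_def bij_betw_def)
  have eb: "e \<inter> P = {b}" "c \<in> e" "c \<noteq> b" "b \<in> e" using lpath_snoc by auto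
  have "bij_betw h ({s + 1..t - 1} \<union> {t}) ((e - {b, c}) \<union> {c})"
    by (rule bij_betw_combine[OF h2 h3]) auto
  moreover have "{s + 1..t - 1} \<union> {t} = {s + 1..t}" using st k_ge_3 by auto
  moreover have "(e - {b, c}) \<union> {c} = e - {b}" using eb by auto
  ultimately have h4: "bij_betw h {s + 1..t} (e - {b})" by simp
  have "bij_betw h ({1..s} \<union> {s + 1..t}) (P \<union> (e - {b}))"
    by (rule bij_betw_combine[OF h1 h4]) (use eb in auto)
  moreover have "{1..s} \<union> {s + 1..t} = {1..t}" using st by auto
  moreover have "P \<union> (e - {b}) = P \<union> e" using eb by auto
  ultimately have h5: "bij_betw h {1..t} (P \<union> e)" by simp
  have hs: "h s = b" using f(2) by (simp add: h_def s_def)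
  have "h ` {s..t} = insert (h s) (h ` {s + 1..t})"
    using st by (subst image_insert[symmetric]) (rule arg_cong[of _ _ "(`) h"], auto)
  also have "\<dots> = e" using hs h4 eb by (auto simp: bij_betw_def)
  finally have he: "h ` {s..t} = e" .
  have r: "red (h ` {(i - 1) * (k - 1) + 1 .. i * (k - 1) + 1})" if i: "1 \<le> i" "i \<le> Suc m" for i
  proof (cases "i = Suc m")
    case True
    then show ?thesis using he lpath_snoc.hyps(2) by (simp add: s_def t_def)
  next
    case False
    then have im: "i \<le> m" using i by simp
    then have "i * (k - 1) + 1 \<le> s" by (simp add: s_def)
    then have "h ` {(i - 1) * (k - 1) + 1 .. i * (k - 1) + 1} = f ` {(i - 1) * (k - 1) + 1 .. i * (k - 1) + 1}"
      by (intro image_cong) (auto simp: h_def)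
    then show ?thesis using f(3) i im by simp
  qed
  show ?case
  proof (rule lpath_snoc.prems)
    show "bij_betw h {1..Suc m * (k - 1) + 1} (P \<union> e)" using h5 by (simp only: t_def)
    show "h (Suc m * (k - 1) + 1) = c" using h3 by (auto simp: t_def bij_betw_def)
  qed (use r in blast)
qed

definition red_clique :: "'v set \<Rightarrow> bool" where
  "red_clique Q \<longleftrightarrow> finite Q \<and> (\<forall>e\<subseteq>Q. card e = k \<longrightarrow> red e)"

lemma red_clique_subset: "red_clique Q \<Longrightarrow> Q' \<subseteq> Q \<Longrightarrow> red_clique Q'"
  by (auto simp: red_clique_def intro: finite_subset)

text \<open>Induction on \<open>j\<close>: an edge \<open>e\<close> through \<open>b\<close> that
  avoids \<open>a\<close> is set aside, and one further vertex \<open>c\<close> of it is kept as the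
  end of a path spanning the rest of the clique.\<close>

lemma red_clique_path_all:
  assumes "red_clique Q" "card Q = j * (k - 1) + 1" "j \<ge> 1" "a \<in> Q" "b \<in> Q" "a \<noteq> b"
  shows "lpath a Q b j"
  using assms(3,1,2,4-)
proof (induction j arbitrary: Q b rule: nat_induct_at_least)
  case base
  then show ?case using k_ge_3 lpath_edge[of Q a b] by (auto simp: red_clique_def)
next
  case (Suc j)
  have fin: "finite Q" using Suc by (simp add: red_clique_def)
  have cQ: "card (Q - {a, b}) = j * (k - 1) + (k - 1) - 1" using Suc fin by simp
  have "1 * 2 \<le> j * (k - 1)" using Suc.hyps k_ge_3 by (intro mult_le_mono) auto
  then have "k - 1 \<le> card (Q - {a, b})" using cQ by simp
  then obtain D where D: "D \<subseteq> Q - {a, b}" "card D = k - 1" "finite D"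
    by (meson obtain_subset_with_card_n)
  then obtain c where c: "c \<in> D" using k_ge_3 by fastforce
  define e where "e = insert b D"
  have e: "card e = k" "e \<subseteq> Q" using D k_ge_3 Suc by (auto simp: e_def card_insert_if)
  have re: "red e" using e Suc by (simp add: red_clique_def)
  define Q' where "Q' = Q - (e - {c})"
  have "card Q' = card Q - card (e - {c})"
    unfolding Q'_def using e fin by (intro card_Diff_subset) (auto intro: finite_subset)
  also have "card (e - {c}) = k - 1" using e c by (simp add: e_def)
  finally have cQ': "card Q' = j * (k - 1) + 1" using Suc by simp
  have "lpath a Q' c j"
  proof (rule Suc.IH)
    show "red_clique Q'" using Suc.prems(1) by (rule red_clique_subset) (auto simp: Q'_def)
  qed (use cQ' D c Suc.prems in \<open>auto simp: Q'_def e_def\<close>)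
  moreover have "lpath c e b 1" using re e c D by (intro lpath_edge) (auto simp: e_def)
  moreover have "Q' \<inter> e = {c}" using c D by (auto simp: Q'_def e_def)
  ultimately have "lpath a (Q' \<union> e) b (j + 1)" using lpath_append by blast
  moreover have "Q' \<union> e = Q" using e c D by (auto simp: Q'_def e_def)
  ultimately show ?case by simp
qed

lemma red_clique_path:
  assumes "red_clique Q" "j * (k - 1) + 1 \<le> card Q" "j \<ge> 1" "a \<in> Q" "b \<in> Q" "a \<noteq> b"
  obtains Q' where "Q' \<subseteq> Q" "lpath a Q' b j"
proof -
  have "finite Q" using assms by (simp add: red_clique_def)
  have "2 * 1 \<le> (k - 1) * j" using assms(3) k_ge_3 by (intro mult_le_mono) auto
  moreover have "card {a, b} = 2" using assms(6) by simp
  ultimately have "card {a, b} \<le> j * (k - 1) + 1" by (simp only: mult.commute[of j])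
  then obtain Q' where "{a, b} \<subseteq> Q'" "Q' \<subseteq> Q" "card Q' = j * (k - 1) + 1"
    using exists_subset_between[of "{a,b}" "j * (k - 1) + 1" Q] assms \<open>finite Q\<close> by auto
  then show ?thesis
    using red_clique_path_all[of Q' j a b] assms red_clique_subset that by simp
qed

text \<open>\<open>D\<close> is the set of vertices the edge must avoid; the prescribed ends may
  belong to it. The \<open>k\<close> vertices of \<open>Q\<close> beyond the size of
  \<open>D\<close> leave room for the edge.\<close>

lemma red_clique_edge:
  assumes "red_clique Q" "finite D" "card D + k \<le> card Q" "a \<in> Q" "b \<in> Q" "a \<noteq> b"
  obtains g where "g \<subseteq> Q" "lpath a g b 1" "card g = k" "g \<inter> D \<subseteq> {a, b}"
proof -
  let ?Q = "(Q - D) \<union> {a, b}"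
  have fin: "finite Q" using assms by (simp add: red_clique_def)
  have "card (Q - D) \<ge> card Q - card D"
    using assms by (intro diff_card_le_card_Diff) auto
  moreover have "card (Q - D) \<le> card ?Q" using fin by (intro card_mono) auto
  ultimately have "1 * (k - 1) + 1 \<le> card ?Q" using assms k_ge_3 by linarith
  moreover have "red_clique ?Q" using assms red_clique_subset[of Q ?Q] by auto
  ultimately obtain g where g: "g \<subseteq> ?Q" "lpath a g b 1"
    using red_clique_path[of ?Q 1 a b] assms by auto
  then show ?thesis using that[of g] lpath_props[of a g b 1] k_ge_3 assms by auto
qed

subsection \<open>Splitting off a blue-joined set\<close>

definition necklace :: "'v set \<Rightarrow> 'v \<Rightarrow> 'v set \<Rightarrow> 'v \<Rightarrow> nat \<Rightarrow> bool" where
  "necklace R a P b m \<longleftrightarrow> red_clique R \<and> lpath a P b m \<and> a \<noteq> b \<and> P \<inter> R = {a, b}"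

definition blue_between :: "'v set \<Rightarrow> 'v set \<Rightarrow> bool" where
  "blue_between S T \<longleftrightarrow> S \<inter> T = {} \<and>
     (\<forall>e\<subseteq>S \<union> T. card e = k \<longrightarrow> e \<inter> S \<noteq> {} \<longrightarrow> e \<inter> T \<noteq> {} \<longrightarrow> \<not> red e)"

text \<open>\<open>R\<close> is a reserve clique, and the paths \<open>P\<close>, \<open>P'\<close> lead from \<open>R\<close> to the tail cliques
  \<open>Q\<close>, \<open>Q'\<close>. The reserve is never used up while the paths grow, so it can be much larger than the
  tails.\<close>

definition dumbbell where
  "dumbbell W L R a P v Q m a' P' v' Q' m' \<longleftrightarrow>
     lpath a P v m \<and> lpath a' P' v' m' \<and> red_clique R \<and> red_clique Q \<and> red_clique Q' \<and>
     card Q = L \<and> card Q' = L \<and> R \<union> P \<union> Q \<union> P' \<union> Q' \<subseteq> W \<and>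
     P \<inter> R = {a} \<and> P' \<inter> R = {a'} \<and> P \<inter> Q = {v} \<and> P' \<inter> Q' = {v'} \<and>
     P \<inter> P' = {} \<and> P \<inter> Q' = {} \<and> P' \<inter> Q = {} \<and> R \<inter> Q = {} \<and> R \<inter> Q' = {} \<and> Q \<inter> Q' = {}"

lemma dumbbellD:
  assumes "dumbbell W L R a P v Q m a' P' v' Q' m'"
  shows "lpath a P v m" "lpath a' P' v' m'" "red_clique R" "red_clique Q" "red_clique Q'"
    "card Q = L" "card Q' = L" "R \<union> P \<union> Q \<union> P' \<union> Q' \<subseteq> W"
    "P \<inter> R = {a}" "P' \<inter> R = {a'}" "P \<inter> Q = {v}" "P' \<inter> Q' = {v'}"
    "P \<inter> P' = {}" "P \<inter> Q' = {}" "P' \<inter> Q = {}" "R \<inter> Q = {}" "R \<inter> Q' = {}" "Q \<inter> Q' = {}"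
  using assms unfolding dumbbell_def by simp_all

lemma dumbbell_swap:
  "dumbbell W L R a P v Q m a' P' v' Q' m' \<Longrightarrow> dumbbell W L R a' P' v' Q' m' a P v Q m"
  unfolding dumbbell_def by (simp add: Int_commute Un_ac)

text \<open>To attach an edge \<open>e\<close> that meets the tail clique, the path is first led by
  a red edge \<open>g\<close> inside \<open>Q\<close> from \<open>v\<close> to \<open>z\<close>,
  with \<open>g\<close> chosen to avoid the rest of \<open>e\<close>. Afterwards \<open>e\<close>
  can be appended at \<open>z\<close>.\<close>

lemma tail_exit:
  assumes P: "lpath a P v m" "P \<inter> Q = {v}" and Q: "red_clique Q" "card e + k \<le> card Q"
    and e: "finite e" "e \<inter> P = {}" "z \<in> e \<inter> Q"
  obtains g where "g \<subseteq> Q" "lpath a (P \<union> g) z (m + 1)" "(P \<union> g) \<inter> e = {z}" "card g = k" "v \<in> g"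
proof -
  have z: "v \<noteq> z" using P e by auto
  have "card (e - {z}) + k \<le> card Q" using e(3) Q(2) by simp
  then obtain g where g: "g \<subseteq> Q" "lpath v g z 1" "card g = k" "g \<inter> (e - {z}) \<subseteq> {v, z}"
    using red_clique_edge[of Q "e - {z}" v z] Q P e z by auto
  have v: "v \<in> g" "z \<in> g" using lpath_props[OF g(2)] by auto
  then have "P \<inter> g = {v}" using P g by auto
  then have "lpath a (P \<union> g) z (m + 1)" using lpath_append[OF g(2) P(1)] by simp
  moreover have "(P \<union> g) \<inter> e = {z}" using v g e P by auto
  ultimately show ?thesis using that g v by blast
qed

text \<open>One growth step: the path runs through the old tail by an edge \<open>g\<close>, crosses
  \<open>e\<close>, and ends in \<open>C\<close>, which supplies the new tail. A dumbbell of
  greatest total length therefore admits no such \<open>e\<close>.\<close>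

lemma dumbbell_extend:
  assumes D: "dumbbell W L R a P v Q m a' P' v' Q' m'" and L: "2 * k \<le> L"
    and U: "U = W - (R \<union> P \<union> Q \<union> P' \<union> Q')"
    and e: "red e" "card e = k" "e \<subseteq> (Q - {v}) \<union> U" "e \<inter> Q \<noteq> {}"
    and C: "C \<subseteq> U" "red_clique C" "card C = L + k" "e \<inter> C \<noteq> {}"
  obtains P2 v2 Q2 where "dumbbell W L R a P2 v2 Q2 (m + 2) a' P' v' Q' m'"
proof -
  note D' = dumbbellD[OF D]
  obtain z where z: "z \<in> e \<inter> Q" using e by blast
  have eP: "e \<inter> P = {}" using e(3) U D'(11) by blast
  have sz: "card e + k \<le> card Q" using L D'(6) e(2) by simp
  then obtain g where g: "g \<subseteq> Q" "lpath a (P \<union> g) z (m + 1)" "(P \<union> g) \<inter> e = {z}"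
    using tail_exit[OF D'(1,11,4) sz finite_edge[OF e(2)] eP z] by blast
  obtain u where u: "u \<in> e" "u \<in> C" using C by blast
  have uz: "u \<noteq> z" using u z C U by auto
  have P2: "lpath a (P \<union> g \<union> e) u (Suc (m + 1))"
    using lpath_snoc[OF g(2) e(1,2) _ u(1) uz] g(3) by (simp add: Int_commute)
  \<comment> \<open>The \<open>k\<close> spare vertices of \<open>C\<close> make up for those that
    \<open>e\<close> may occupy.\<close>
  have "card (C - e) \<ge> card C - card e" using finite_edge e by (intro diff_card_le_card_Diff) auto
  then have "L - 1 \<le> card (C - e)" using C e by simp
  then obtain F where F: "F \<subseteq> C - e" "card F = L - 1" "finite F"
    by (meson obtain_subset_with_card_n)
  have cF: "card (insert u F) = L" using F u L k_ge_3 by (subst card_insert_disjoint) auto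
  have rF: "red_clique (insert u F)" by (rule red_clique_subset[OF C(2)]) (use F u in auto)
  have gW: "g \<subseteq> W" and eW: "e \<subseteq> W" using g(1) e(3) U D'(8) by blast+
  have FU: "insert u F \<subseteq> U" using F(1) C(1) u by blast
  have "dumbbell W L R a (P \<union> g \<union> e) u (insert u F) (m + 2) a' P' v' Q' m'"
    unfolding dumbbell_def
  proof (intro conjI)
    show "lpath a (P \<union> g \<union> e) u (m + 2)" using P2 by simp
    show "R \<union> (P \<union> g \<union> e) \<union> insert u F \<union> P' \<union> Q' \<subseteq> W"
      using D'(8) gW eW FU U by blast
    have "g \<inter> R = {}" "e \<inter> R = {}" using g(1) e(3) D'(16) U by blast+
    then show "(P \<union> g \<union> e) \<inter> R = {a}" by (simp add: Int_Un_distrib2 D')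
    have "g \<inter> P' = {}" "e \<inter> P' = {}" using g(1) e(3) D'(15) U by blast+
    then show "(P \<union> g \<union> e) \<inter> P' = {}" by (simp add: Int_Un_distrib2 D')
    have "g \<inter> Q' = {}" "e \<inter> Q' = {}" using g(1) e(3) D'(18) U by blast+
    then show "(P \<union> g \<union> e) \<inter> Q' = {}" by (simp add: Int_Un_distrib2 D')
    have "P \<inter> insert u F = {}" "g \<inter> insert u F = {}" using FU g(1) U by blast+
    moreover have "e \<inter> insert u F = {u}" using F(1) u by blast
    ultimately show "(P \<union> g \<union> e) \<inter> insert u F = {u}" by (simp add: Int_Un_distrib2)
    show "P' \<inter> insert u F = {}" "R \<inter> insert u F = {}" "insert u F \<inter> Q' = {}"
      using FU U by blast+
  qed (simp_all add: D' cF rF)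
  then show ?thesis using that by blast
qed

text \<open>A red edge that meets both tails joins the two paths; the \<open>3\<close> edges added
  are \<open>e\<close> and one edge inside each tail that leads to it. Both free ends lie in
  \<open>R\<close>, so the result is a necklace.\<close>

lemma dumbbell_close:
  assumes D: "dumbbell W L R a P v Q m a' P' v' Q' m'" and L: "2 * k \<le> L"
    and U: "U = W - (R \<union> P \<union> Q \<union> P' \<union> Q')"
    and e: "red e" "card e = k" "e \<subseteq> (Q - {v}) \<union> (Q' - {v'}) \<union> U" "e \<inter> Q \<noteq> {}" "e \<inter> Q' \<noteq> {}"
  obtains P2 where "necklace R a P2 a' (m + m' + 3)" "P \<union> P' \<union> e \<subseteq> P2" "P2 \<subseteq> P \<union> P' \<union> Q \<union> Q' \<union> e"
proof -
  note D' = dumbbellD[OF D]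
  obtain z z' where z: "z \<in> e \<inter> Q" "z' \<in> e \<inter> Q'" using e by blast
  have eP: "e \<inter> P = {}" using e(3) U D'(11,14) by blast
  have sz: "card e + k \<le> card Q" "card e + k \<le> card Q'" using L D'(6,7) e(2) by simp_all
  have eP': "e \<inter> P' = {}" using e(3) U D'(12,15) by blast
  then obtain g where g: "g \<subseteq> Q" "lpath a (P \<union> g) z (m + 1)" "(P \<union> g) \<inter> e = {z}"
    using tail_exit[OF D'(1,11,4) sz(1) finite_edge[OF e(2)] eP z(1)] by blast
  obtain g' where g': "g' \<subseteq> Q'" "lpath a' (P' \<union> g') z' (m' + 1)" "(P' \<union> g') \<inter> e = {z'}"
    using tail_exit[OF D'(2,12,5) sz(2) finite_edge[OF e(2)] eP' z(2)] by blast
  have zz: "z' \<noteq> z" using z D' by auto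
  have 1: "lpath a (P \<union> g \<union> e) z' (Suc (m + 1))"
    using lpath_snoc[OF g(2) e(1,2) _ _ zz] g(3) z by (simp add: Int_commute)
  have "P \<inter> (P' \<union> g') = {}" "g \<inter> (P' \<union> g') = {}"
    using g(1) g'(1) D'(13-15,18) by blast+
  moreover have "e \<inter> (P' \<union> g') = {z'}" using g'(3) by blast
  ultimately have "(P \<union> g \<union> e) \<inter> (P' \<union> g') = {z'}" by (simp add: Int_Un_distrib2)
  then have "lpath a ((P \<union> g \<union> e) \<union> (P' \<union> g')) a' (Suc (m + 1) + (m' + 1))"
    using lpath_append[OF lpath_rev[OF g'(2)] 1] by simp
  moreover have "a \<noteq> a'" using D'(9,10,13) by blast
  moreover have "((P \<union> g \<union> e) \<union> (P' \<union> g')) \<inter> R = {a, a'}"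
  proof -
    have "g \<inter> R = {}" "g' \<inter> R = {}" "e \<inter> R = {}"
      using g(1) g'(1) e(3) U D'(16,17) by blast+
    then show ?thesis using D'(9,10) by (simp add: Int_Un_distrib2 insert_commute)
  qed
  ultimately have "necklace R a ((P \<union> g \<union> e) \<union> (P' \<union> g')) a' (m + m' + 3)"
    unfolding necklace_def using D' by (simp add: numeral_3_eq_3)
  then show ?thesis using that g g' by blast
qed

text \<open>The bound on \<open>m + m'\<close> makes it possible to choose a dumbbell of greatest
  total length.\<close>

lemma dumbbell_card:
  assumes D: "dumbbell W L R a P v Q m a' P' v' Q' m'" "finite W"
  shows "m + m' \<le> card W" "card P = m * (k - 1) + 1" "card P' = m' * (k - 1) + 1"
proof -
  note D' = dumbbellD[OF D(1)]
  show c: "card P = m * (k - 1) + 1" "card P' = m' * (k - 1) + 1"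
    using lpath_props[OF D'(1)] lpath_props[OF D'(2)] by simp_all
  have "card (P \<union> P') = card P + card P'"
    using D'(13) lpath_props[OF D'(1)] lpath_props[OF D'(2)] by (intro card_Un_disjoint) auto
  moreover have "card (P \<union> P') \<le> card W" using D'(8) D(2) by (intro card_mono) auto
  moreover have "m \<le> m * (k - 1)" "m' \<le> m' * (k - 1)" using k_ge_3 by auto
  ultimately show "m + m' \<le> card W" using c by linarith
qed

text \<open>An edge inside the reserve \<open>R\<close> joins \<open>a\<close> to \<open>a'\<close>,
  so both paths count as one when the absence of long paths is invoked.\<close>

lemma dumbbell_path:
  assumes D: "dumbbell W L R a P v Q m a' P' v' Q' m'" and R: "k \<le> card R"
  obtains P2 where "lpath v P2 v' (m + m' + 1)" "P2 \<subseteq> W"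
proof -
  note D' = dumbbellD[OF D]
  have "a \<noteq> a'" "a \<in> R" "a' \<in> R" using D'(9,10,13) by blast+
  then obtain g where g: "g \<subseteq> R" "lpath a g a' 1"
    using red_clique_edge[of R "{}" a a'] R D'(3) by auto
  have ag: "a \<in> g" "a' \<in> g" using lpath_props[OF g(2)] by auto
  note rP = lpath_rev[OF D'(1)]
  have "P \<inter> g = {a}" using D'(9) g(1) ag by blast
  then have 1: "lpath v (P \<union> g) a' (m + 1)" using lpath_append[OF g(2) rP] by simp
  have "(P \<union> g) \<inter> P' = {a'}" using D'(10,13) g(1) ag by blast
  from lpath_append[OF D'(2) 1 this]
  have "lpath v ((P \<union> g) \<union> P') v' (m + m' + 1)" by (simp add: add_ac)
  moreover have "(P \<union> g) \<union> P' \<subseteq> W" using D'(8) g(1) by blast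
  ultimately show ?thesis using that by blast
qed

text \<open>A single large clique is cut up: \<open>L1\<close> vertices for the reserve,
  \<open>L\<close> for each tail and \<open>k - 2\<close> for the interior of each of the two first
  edges.\<close>

lemma dumbbell_exists:
  assumes Q0: "Q0 \<subseteq> W" "red_clique Q0" "card Q0 = L1 + 2 * L + 2 * k" and L: "1 \<le> L" and L1: "2 \<le> L1"
  obtains R a P v Q a' P' v' Q' where "dumbbell W L R a P v Q 1 a' P' v' Q' 1" "card R = L1"
proof -
  have fin: "finite Q0" using Q0 by (simp add: red_clique_def)
  obtain R where R: "R \<subseteq> Q0" "card R = L1"
    using obtain_subset_with_card_n[of L1 Q0] Q0(3) by auto
  obtain a a' where a: "a \<in> R" "a' \<in> R" "a \<noteq> a'"
    using card_le_Suc0_iff_eq[OF finite_subset[OF R(1) fin]] R(2) L1 by auto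
  have cut: "\<exists>C. C \<subseteq> X \<and> card C = c \<and> card (X - C) = card X - c" if "finite X" "c \<le> card X" for X :: "'v set" and c
    using that by (metis obtain_subset_with_card_n card_Diff_subset)
  have c1: "card (Q0 - R) = 2 * L + 2 * k" using R Q0 fin by (simp add: card_Diff_subset finite_subset[OF R(1) fin])
  have "L \<le> card (Q0 - R)" unfolding c1 by simp
  from cut[OF finite_Diff[OF fin] this]
  obtain Q where Q: "Q \<subseteq> Q0 - R" "card Q = L" "card (Q0 - R - Q) = L + 2 * k"
    unfolding c1 by force
  have "L \<le> card (Q0 - R - Q)" unfolding Q(3) by simp
  from cut[OF finite_Diff[OF finite_Diff[OF fin]] this]
  obtain Q' where Q': "Q' \<subseteq> Q0 - R - Q" "card Q' = L" "card (Q0 - R - Q - Q') = 2 * k"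
    unfolding Q(3) by force
  have "k - 2 \<le> card (Q0 - R - Q - Q')" unfolding Q'(3) by simp
  from cut[OF finite_Diff[OF finite_Diff[OF finite_Diff[OF fin]]] this]
  obtain D where D: "D \<subseteq> Q0 - R - Q - Q'" "card D = k - 2" "card (Q0 - R - Q - Q' - D) = 2 * k - (k - 2)"
    unfolding Q'(3) by force
  have "k - 2 \<le> card (Q0 - R - Q - Q' - D)" unfolding D(3) by simp
  from cut[OF finite_Diff[OF finite_Diff[OF finite_Diff[OF finite_Diff[OF fin]]]] this]
  obtain D' where D': "D' \<subseteq> Q0 - R - Q - Q' - D" "card D' = k - 2"
    by blast
  obtain v v' where v: "v \<in> Q" "v' \<in> Q'" using Q Q' L by fastforce
  have edge: "lpath x (insert x (insert y E)) y 1"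
    if "x \<in> Q0" "y \<in> Q0" "x \<noteq> y" "E \<subseteq> Q0 - {x, y}" "card E = k - 2" for x y E
  proof (rule lpath_edge)
    have "finite E" using that fin finite_subset by blast
    then show "card (insert x (insert y E)) = k" using that k_ge_3 by (subst card_insert_disjoint; auto)+
    moreover have "insert x (insert y E) \<subseteq> Q0" using that by blast
    ultimately show "red (insert x (insert y E))" using Q0(2) unfolding red_clique_def by blast
  qed (use that in auto)
  have p: "lpath a (insert a (insert v D)) v 1" "lpath a' (insert a' (insert v' D')) v' 1"
    by (rule edge; use a v R Q Q' D D' in auto)+
  have "dumbbell W L R a (insert a (insert v D)) v Q 1 a' (insert a' (insert v' D')) v' Q' 1"
    unfolding dumbbell_def
  proof (intro conjI)
    show "red_clique R" "red_clique Q" "red_clique Q'"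
      by (rule red_clique_subset[OF Q0(2)]; use R Q Q' in auto)+
  qed (use p a v R Q Q' D D' Q0(1) in \<open>simp, auto\<close>)
  then show ?thesis using that R by blast
qed

text \<open>In a longest dumbbell, all but one vertex of each tail are blue-joined to the set
  \<open>T\<close> of outside vertices that lie in a large clique there. Either the tails are also
  blue-joined to each other, or a red edge meeting both closes the dumbbell to a necklace.\<close>

lemma split_step:
  assumes W: "finite W" "Q0 \<subseteq> W" "red_clique Q0" "card Q0 = L1 + 2 * L + 2 * k"
    and M: "\<forall>U\<subseteq>W. M \<le> card U \<longrightarrow> (\<exists>C\<subseteq>U. red_clique C \<and> card C = L + k)"
    and L: "2 * k \<le> L" and L1: "k \<le> L1"
  shows "(\<exists>a P b m S S' T. lpath a P b m \<and> P \<subseteq> W \<and> S \<subseteq> W \<and> S' \<subseteq> W \<and> T \<subseteq> W \<and>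
            card S = L - 1 \<and> card S' = L - 1 \<and> blue_between S (S' \<union> T) \<and> blue_between S' T \<and>
            card W \<le> card T + m * (k - 1) + 1 + (L1 + 2 * L + M))
       \<or> (\<exists>R a P b m S T. necklace R a P b m \<and> R \<union> P \<subseteq> W \<and> card R = L1 \<and> S \<subseteq> W \<and> T \<subseteq> W - (R \<union> P) \<and>
            card S = L - 1 \<and> blue_between S T \<and> card W \<le> card T + card (R \<union> P) + (2 * L + M + k))"
proof -
  define good where "good = (\<lambda>(R, (a, P, v, Q, m), (a', P', v', Q', m')).
     dumbbell W L R a P v Q m a' P' v' Q' m' \<and> card R = L1)"
  define len where "len = (\<lambda>(R :: 'v set, (a :: 'v, P :: 'v set, v :: 'v, Q :: 'v set, m), (a' :: 'v, P' :: 'v set, v' :: 'v, Q' :: 'v set, m')).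
     m + m' :: nat)"
  have sizes: "1 \<le> L" "2 \<le> L1" using L L1 k_ge_3 by linarith+
  have "\<exists>x. good x"
  proof -
    obtain R a P v Q a' P' v' Q' where "dumbbell W L R a P v Q 1 a' P' v' Q' 1" "card R = L1"
      using dumbbell_exists[OF W(2-4) sizes] by blast
    then have "good (R, (a, P, v, Q, 1), (a', P', v', Q', 1))" by (simp add: good_def)
    then show ?thesis by blast
  qed
  moreover have "\<forall>x. good x \<longrightarrow> len x < Suc (card W)"
    unfolding good_def len_def using dumbbell_card(1) W(1) by (auto simp: less_Suc_eq_le)
  ultimately obtain x where x: "good x" "\<forall>y. good y \<longrightarrow> len y \<le> len x"
    using ex_has_greatest_nat[of good _ len "Suc (card W)"] by blast
  obtain R a P v Q m a' P' v' Q' m' where xe: "x = (R, (a, P, v, Q, m), (a', P', v', Q', m'))"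
    by (metis surj_pair)
  have D: "dumbbell W L R a P v Q m a' P' v' Q' m'" and cR: "card R = L1"
    using x(1) by (auto simp: xe good_def)
  have max: "m2 + m2' \<le> m + m'" if "dumbbell W L R a2 P2 v2 Q2 m2 a2' P2' v2' Q2' m2'"
    for a2 P2 v2 Q2 m2 a2' P2' v2' Q2' m2'
    using x(2)[rule_format, of "(R, (a2, P2, v2, Q2, m2), (a2', P2', v2', Q2', m2'))"] that cR
    by (simp add: xe good_def len_def)
  note D' = dumbbellD[OF D]
  define U where "U = W - (R \<union> P \<union> Q \<union> P' \<union> Q')"
  \<comment> \<open>Every vertex of \<open>T\<close> lies in a clique that could supply a new tail.
    Fewer than \<open>M\<close> vertices of \<open>U\<close> are not of this kind, since
    \<open>M\<close> of them would contain such a clique.\<close>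
  define T where "T = \<Union>{C. C \<subseteq> U \<and> red_clique C \<and> card C = L + k}"
  have TU: "T \<subseteq> U" by (auto simp: T_def)
  have UW: "U \<subseteq> W" by (auto simp: U_def)
  have "card (U - T) < M"
  proof (rule ccontr)
    assume "\<not> card (U - T) < M"
    then obtain C where C: "C \<subseteq> U - T" "red_clique C" "card C = L + k"
      using M[rule_format, of "U - T"] UW by auto
    then have "C \<subseteq> T" unfolding T_def by blast
    with C have "C = {}" by auto
    with C L k_ge_3 show False by simp
  qed
  moreover have "finite U" using UW W(1) finite_subset by blast
  ultimately have cU: "card U < card T + M"
    using TU card_Diff_subset[of T U] finite_subset[OF TU] by (metis card_mono le_add_diff_inverse nat_add_left_cancel_less)
  have cW: "card W = card U + card (R \<union> P \<union> Q \<union> P' \<union> Q')"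
    unfolding U_def using card_Diff_subset[OF finite_subset[OF D'(8) W(1)] D'(8)] card_mono[OF W(1) D'(8)]
    by linarith
  have Tcl: "\<exists>C\<subseteq>U. red_clique C \<and> card C = L + k \<and> e \<inter> C \<noteq> {}" if "e \<inter> T \<noteq> {}" for e
    using that unfolding T_def by blast
  have b1: "blue_between (Q - {v}) T"
    unfolding blue_between_def
  proof (intro conjI allI impI notI)
    fix e assume e: "e \<subseteq> (Q - {v}) \<union> T" "card e = k" "e \<inter> (Q - {v}) \<noteq> {}" "e \<inter> T \<noteq> {}" "red e"
    obtain C where C: "C \<subseteq> U" "red_clique C" "card C = L + k" "e \<inter> C \<noteq> {}" using Tcl[OF e(4)] by blast
    have eU: "e \<subseteq> (Q - {v}) \<union> U" "e \<inter> Q \<noteq> {}" using e(1,3) TU by blast+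
    obtain P2 v2 Q2 where "dumbbell W L R a P2 v2 Q2 (m + 2) a' P' v' Q' m'"
      by (rule dumbbell_extend[OF D L U_def e(5,2) eU C])
    from max[OF this] show False by simp
  qed (use TU in \<open>auto simp: U_def\<close>)
  have b2: "blue_between (Q' - {v'}) T"
    unfolding blue_between_def
  proof (intro conjI allI impI notI)
    fix e assume e: "e \<subseteq> (Q' - {v'}) \<union> T" "card e = k" "e \<inter> (Q' - {v'}) \<noteq> {}" "e \<inter> T \<noteq> {}" "red e"
    obtain C where C: "C \<subseteq> U" "red_clique C" "card C = L + k" "e \<inter> C \<noteq> {}" using Tcl[OF e(4)] by blast
    have eU: "e \<subseteq> (Q' - {v'}) \<union> U" "e \<inter> Q' \<noteq> {}" using e(1,3) TU by blast+
    have U': "U = W - (R \<union> P' \<union> Q' \<union> P \<union> Q)" by (auto simp: U_def)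
    obtain P2 v2 Q2 where "dumbbell W L R a' P2 v2 Q2 (m' + 2) a P v Q m"
      by (rule dumbbell_extend[OF dumbbell_swap[OF D] L U' e(5,2) eU C])
    from max[OF this] show False by simp
  qed (use TU in \<open>auto simp: U_def\<close>)
  have fins: "finite R" "finite P" "finite Q" "finite P'" "finite Q'"
    using D'(3-5) lpath_props[OF D'(1)] lpath_props[OF D'(2)] by (auto simp: red_clique_def)
  have cQ: "card (Q - {v}) = L - 1" "card (Q' - {v'}) = L - 1"
  proof -
    have "v \<in> Q" "v' \<in> Q'" using D'(11,12) by auto
    then show "card (Q - {v}) = L - 1" "card (Q' - {v'}) = L - 1" using D'(6,7) by auto
  qed
  \<comment> \<open>The edge sought may also use vertices of \<open>T\<close>: only then does its
    absence make one tail blue-joined to the union of the other tail and \<open>T\<close>.\<close>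
  show ?thesis
  proof (cases "\<exists>e. red e \<and> card e = k \<and> e \<subseteq> (Q - {v}) \<union> (Q' - {v'}) \<union> T \<and> e \<inter> Q \<noteq> {} \<and> e \<inter> Q' \<noteq> {}")
    case True
    then obtain e where e: "red e" "card e = k" "e \<subseteq> (Q - {v}) \<union> (Q' - {v'}) \<union> T" "e \<inter> Q \<noteq> {}" "e \<inter> Q' \<noteq> {}"
      by blast
    have eU: "e \<subseteq> (Q - {v}) \<union> (Q' - {v'}) \<union> U" using e(3) TU by blast
    obtain P2 where P2: "necklace R a P2 a' (m + m' + 3)" "P \<union> P' \<union> e \<subseteq> P2" "P2 \<subseteq> P \<union> P' \<union> Q \<union> Q' \<union> e"
      by (rule dumbbell_close[OF D L U_def e(1,2) eU e(4,5)])
    have fe: "finite e" using finite_edge e by blast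
    \<comment> \<open>The necklace may swallow vertices of \<open>T\<close> through
      \<open>e\<close>, so \<open>T - e\<close> is used, at a loss of at most
      \<open>k\<close>.\<close>
    have cT: "card T \<le> card (T - e) + k"
      using diff_card_le_card_Diff[OF fe, of T] e by simp
    have "card (R \<union> P \<union> Q \<union> P' \<union> Q') \<le> card (R \<union> P2) + card Q + card Q'"
    proof -
      have "finite P2" using P2 lpath_props by (auto simp: necklace_def)
      then have "card (R \<union> P \<union> Q \<union> P' \<union> Q') \<le> card ((R \<union> P2) \<union> Q \<union> Q')"
        using P2 fins by (intro card_mono) auto
      then show ?thesis using card_Un_le[of "R \<union> P2 \<union> Q" Q'] card_Un_le[of "R \<union> P2" Q] by linarith
    qed
    then have c: "card W \<le> card (T - e) + card (R \<union> P2) + (2 * L + M + k)"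
      using cW cU cT D'(6,7) by linarith
    have b: "blue_between (Q - {v}) (T - e)" using b1 unfolding blue_between_def by blast
    have "P2 \<subseteq> W" using P2(3) D'(8) e(3) TU UW by blast
    then have s: "R \<union> P2 \<subseteq> W" "Q - {v} \<subseteq> W" using D'(8) by blast+
    have "T - e \<subseteq> W - (R \<union> P2)" using P2(3) TU U_def by blast
    note s = s this
    show ?thesis using P2(1) cR cQ(1) c b s by blast
  next
    case False
    obtain P2 where P2: "lpath v P2 v' (m + m' + 1)" "P2 \<subseteq> W"
      using dumbbell_path[OF D] cR L1 by blast
    have b: "blue_between (Q - {v}) ((Q' - {v'}) \<union> T)"
      unfolding blue_between_def
    proof (intro conjI allI impI notI)
      fix e assume e: "e \<subseteq> (Q - {v}) \<union> ((Q' - {v'}) \<union> T)" "card e = k" "e \<inter> (Q - {v}) \<noteq> {}"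
        "e \<inter> ((Q' - {v'}) \<union> T) \<noteq> {}" "red e"
      show False
      proof (cases "e \<inter> Q' = {}")
        case True
        then have "e \<subseteq> (Q - {v}) \<union> T" "e \<inter> T \<noteq> {}" using e by auto
        with e b1 show ?thesis unfolding blue_between_def by blast
      next
        case f: False
        have "e \<subseteq> (Q - {v}) \<union> (Q' - {v'}) \<union> T" "e \<inter> Q \<noteq> {}" using e by auto
        with f e False show ?thesis by blast
      qed
    qed (use TU D'(18) in \<open>auto simp: U_def\<close>)
    have "card (R \<union> P \<union> Q \<union> P' \<union> Q') \<le> card R + card P + card Q + card P' + card Q'"
      using card_Un_le[of "R \<union> P \<union> Q \<union> P'" Q'] card_Un_le[of "R \<union> P \<union> Q" P'] card_Un_le[of "R \<union> P" Q] card_Un_le[of R P]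
      by linarith
    also have "\<dots> = L1 + 2 * L + (m + m') * (k - 1) + 2"
      using dumbbell_card(2,3)[OF D W(1)] D'(6,7) cR by (simp add: add_mult_distrib)
    finally have "card W \<le> card T + (m + m') * (k - 1) + 2 + (L1 + 2 * L + M)" using cW cU by linarith
    \<comment> \<open>The joined path has one edge more, hence at least as many vertices as the two
      paths together.\<close>
    also have "\<dots> \<le> card T + (m + m' + 1) * (k - 1) + 1 + (L1 + 2 * L + M)"
      using k_ge_3 by (simp add: add_mult_distrib)
    finally have c: "card W \<le> card T + (m + m' + 1) * (k - 1) + 1 + (L1 + 2 * L + M)" .
    have s: "Q - {v} \<subseteq> W" "Q' - {v'} \<subseteq> W" "T \<subseteq> W" using D'(8) TU UW by blast+
    show ?thesis using P2 cQ c b b2 s by blast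
  qed
qed

subsection \<open>Decomposition into necklaces\<close>

text \<open>The structure into which a properly coloured \<open>k\<close>-graph embeds in blue, one
  colour class into each part: no edge then lies inside one part.\<close>

definition blue_parts :: "(nat \<Rightarrow> 'v set) \<Rightarrow> nat \<Rightarrow> bool" where
  "blue_parts B s \<longleftrightarrow> (\<forall>i<s. \<forall>j<s. i \<noteq> j \<longrightarrow> B i \<inter> B j = {}) \<and>
     (\<forall>e. e \<subseteq> (\<Union>i<s. B i) \<longrightarrow> card e = k \<longrightarrow> (\<forall>i<s. \<not> e \<subseteq> B i) \<longrightarrow> \<not> red e)"

lemma blue_parts_single: "blue_parts B (Suc 0)"
  by (auto simp: blue_parts_def)

lemma blue_parts_extend:
  assumes B: "blue_parts B s" and S: "blue_between S T" and T: "\<And>i. i < s \<Longrightarrow> B i \<subseteq> T"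
  shows "blue_parts (B(s := S)) (Suc s)"
  unfolding blue_parts_def
proof (intro conjI allI impI)
  fix i j assume "i < Suc s" "j < Suc s" "i \<noteq> j"
  moreover have "S \<inter> B i = {}" if "i < s" for i
    using S T[OF that] unfolding blue_between_def by blast
  moreover have "B i \<inter> B j = {}" if "i < s" "j < s" "i \<noteq> j" for i j
    using B that by (simp add: blue_parts_def)
  ultimately show "(B(s := S)) i \<inter> (B(s := S)) j = {}"
    by (cases "i = s"; cases "j = s") (simp_all add: Int_commute)
next
  fix e assume e: "e \<subseteq> (\<Union>i<Suc s. (B(s := S)) i)" "card e = k" "\<forall>i<Suc s. \<not> e \<subseteq> (B(s := S)) i"
  have sub: "e \<subseteq> S \<union> (\<Union>i<s. B i)"
    using e(1) by (auto simp: less_Suc_eq split: if_splits)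
  have nS: "\<not> e \<subseteq> S" using e(3)[rule_format, of s] by simp
  show "\<not> red e"
  proof (cases "e \<inter> S = {}")
    case True
    then have 1: "e \<subseteq> (\<Union>i<s. B i)" using sub by auto
    have "\<not> e \<subseteq> B i" if "i < s" for i using e(3)[rule_format, of i] that by simp
    with 1 e(2) B show ?thesis by (auto simp: blue_parts_def)
  next
    case False
    have "(\<Union>i<s. B i) \<subseteq> T" using T by blast
    then have "e \<subseteq> S \<union> T" "e \<inter> T \<noteq> {}" using sub nS by blast+
    with False e(2) S show ?thesis by (simp add: blue_between_def)
  qed
qed

lemma necklace_card:
  assumes "necklace R a P b m"
  shows "finite (R \<union> P)" "card (R \<union> P) + 1 = m * (k - 1) + card R" "2 \<le> card R"
proof -
  note N = assms[unfolded necklace_def]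
  have P: "finite P" "card P = m * (k - 1) + 1" using N lpath_props[of a P b m] by auto
  have R: "finite R" using N by (simp add: red_clique_def)
  show "finite (R \<union> P)" using P R by simp
  have "card (P \<inter> R) = 2" using N by simp
  then show "card (R \<union> P) + 1 = m * (k - 1) + card R"
    using card_Un_Int[OF P(1) R] P by (simp add: Un_commute)
  have "{a, b} \<subseteq> R" using N by blast
  then show "2 \<le> card R" using card_mono[OF R, of "{a, b}"] N by auto
qed

text \<open>If \<open>P\<close> is too short, the path goes on from its end \<open>b\<close> through
  \<open>R - {a}\<close>. As \<open>P\<close> and \<open>R\<close> share just two vertices, enough
  of the clique is left; a third vertex of \<open>R\<close> serves as the final end.\<close>

lemma necklace_path:
  assumes N: "necklace R a P b m" and c: "q * (k - 1) + 1 \<le> card (R \<union> P)" and kR: "3 \<le> card R"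
  obtains P' x where "lpath a P' x q" "P' \<subseteq> R \<union> P"
proof (cases "q \<le> m")
  case True
  then obtain P' b' where "P' \<subseteq> P" "lpath a P' b' q" using lpath_prefix[of a P b m q] N
    by (auto simp: necklace_def)
  then show ?thesis using that by blast
next
  case False
  note N' = N[unfolded necklace_def]
  have fR: "finite R" using N' by (simp add: red_clique_def)
  have ab: "a \<in> R" "b \<in> R" using N' by auto
  have "card (R - {a, b}) \<noteq> 0" using fR ab kR N' by (subst card_Diff_subset) auto
  then have "R - {a, b} \<noteq> {}" by (metis card.empty)
  then obtain x where x: "x \<in> R" "x \<noteq> a" "x \<noteq> b" by blast
  define j where "j = q - m"
  have j: "q = m + j" "1 \<le> j" using False by (auto simp: j_def)
  have "j * (k - 1) + 1 \<le> card (R - {a})"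
    using c necklace_card(2)[OF N] ab fR j by (simp add: add_mult_distrib)
  then obtain Q where Q: "Q \<subseteq> R - {a}" "lpath b Q x j"
    using red_clique_path[of "R - {a}" j b x] red_clique_subset[of R "R - {a}"] j(2) ab x N' by auto
  have "P \<inter> Q = {b}" using Q(1) N' lpath_props[OF Q(2)] by blast
  then have "lpath a (P \<union> Q) x q" using lpath_append[OF Q(2)] N' j(1) by blast
  then show ?thesis using that[of "P \<union> Q"] Q by blast
qed

text \<open>Induction on \<open>s\<close>, with \<open>W\<close> and \<open>D\<close> general.
  \<open>D\<close> is the amount by which \<open>W\<close> may fall short of the
  \<open>s * (q * (k - 1))\<close> vertices that \<open>s\<close> necklaces could cover, and
  \<open>c\<close> is what is lost when a necklace is split off; the assumption on \<open>q\<close>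
  keeps both negligible.\<close>

lemma necklace_decomposition:
  fixes L L1 M M' K q :: nat
  defines "c \<equiv> 2 * L + M + k"
  assumes fin: "finite \<Omega>" and L: "2 * k \<le> L" "K < L" and L1: "k \<le> L1"
    and M: "\<And>U. U \<subseteq> \<Omega> \<Longrightarrow> M \<le> card U \<Longrightarrow> \<exists>C\<subseteq>U. red_clique C \<and> card C = L + k"
    and M': "\<And>U. U \<subseteq> \<Omega> \<Longrightarrow> M' \<le> card U \<Longrightarrow> \<exists>C\<subseteq>U. red_clique C \<and> card C = L1 + 2 * L + 2 * k"
    and W: "W \<subseteq> \<Omega>" "s * (q * (k - 1)) \<le> card W + D" "D + s * c + (M' + c + L1 + K) < q"
    and no_path: "\<And>a P b. lpath a P b q \<Longrightarrow> \<not> P \<subseteq> \<Omega>"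
  shows "(\<exists>B. blue_parts B (Suc s) \<and> (\<forall>i\<le>s. B i \<subseteq> W \<and> K \<le> card (B i)))
       \<or> (\<exists>R a P b m. (\<forall>i<s. necklace (R i) (a i) (P i) (b i) (m i) \<and> R i \<union> P i \<subseteq> W \<and> card (R i) = L1) \<and>
            (\<forall>i<s. \<forall>j<s. i \<noteq> j \<longrightarrow> (R i \<union> P i) \<inter> (R j \<union> P j) = {}) \<and>
            card (W - (\<Union>i<s. R i \<union> P i)) \<le> s * c + K)"
  using W
proof (induction s arbitrary: W D rule: less_induct)
  case (less s)
  have finW: "finite W" using less.prems(1) fin finite_subset by blast
  have no_long: "m < q" if l: "lpath a P b m" "P \<subseteq> \<Omega>" for a P b m
  proof (rule ccontr)
    assume "\<not> m < q"
    then obtain P' b' where "P' \<subseteq> P" "lpath a P' b' q" using lpath_prefix[OF l(1), of q] by auto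
    then show False using no_path[of a P' b'] l(2) by blast
  qed
  have small: "card (R \<union> P) \<le> q * (k - 1)"
    if N: "necklace R a P b m" "R \<union> P \<subseteq> \<Omega>" "card R = L1" for R a P b m
  proof (rule ccontr)
    assume "\<not> card (R \<union> P) \<le> q * (k - 1)"
    then obtain P' x where "lpath a P' x q" "P' \<subseteq> R \<union> P"
      using necklace_path[OF N(1), of q] N(3) L1 k_ge_3 by auto
    then show False using no_path[of a P' x] N(2) by blast
  qed
  show ?case
  proof (cases s)
    case 0
    \<comment> \<open>With no necklace left to find, \<open>W\<close> is itself a part unless it has
      fewer than \<open>K\<close> vertices.\<close>
    show ?thesis
    proof (cases "K \<le> card W")
      case True
      then show ?thesis using blue_parts_single[of "\<lambda>_. W"] 0 by auto
    qed (use 0 in auto)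
  next
    case (Suc t)
    have "q \<le> q * (k - 1)" using k_ge_3 by auto
    also have "\<dots> \<le> s * (q * (k - 1))" using Suc by simp
    finally have "M' \<le> card W" using less.prems(2,3) by linarith
    then obtain Q0 where Q0: "Q0 \<subseteq> W" "red_clique Q0" "card Q0 = L1 + 2 * L + 2 * k"
      using M'[OF less.prems(1)] by blast
    have MW: "\<forall>U\<subseteq>W. M \<le> card U \<longrightarrow> (\<exists>C\<subseteq>U. red_clique C \<and> card C = L + k)"
      using M less.prems(1) by blast
    from split_step[OF finW Q0 MW L(1) L1] show ?thesis
    proof (elim disjE exE conjE, goal_cases a b)
      case (a a P b m S S' T)
      have KS: "K \<le> card S" "K \<le> card S'" using a L by auto
      have two: ?thesis if B: "blue_parts B s" "\<forall>i<s. B i \<subseteq> S' \<union> T \<and> K \<le> card (B i)" for B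
      proof -
        have "blue_parts (B(s := S)) (Suc s)" using blue_parts_extend[OF B(1) a(8)] B(2) by blast
        moreover have "\<forall>i\<le>s. (B(s := S)) i \<subseteq> W \<and> K \<le> card ((B(s := S)) i)"
        proof (intro allI impI)
          fix i assume "i \<le> s"
          then show "(B(s := S)) i \<subseteq> W \<and> K \<le> card ((B(s := S)) i)"
            using B(2)[rule_format, of i] KS a(3-5) by (cases "i = s") (simp_all, blast)
        qed
        ultimately show ?thesis by blast
      qed
      show ?thesis
      proof (cases t)
        case 0
        then show ?thesis using two[of "\<lambda>_. S'"] blue_parts_single KS Suc by auto
      next
        case (Suc r)
        have TO: "T \<subseteq> \<Omega>" using a(5) less.prems(1) by blast
        have "m < q" using no_long a(1,2) less.prems(1) by blast
        then have "(m + 1) * (k - 1) \<le> q * (k - 1)" by (intro mult_le_mono) auto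
        then have mq: "m * (k - 1) + (k - 1) \<le> q * (k - 1)" by simp
        have sr: "s * (q * (k - 1)) = r * (q * (k - 1)) + q * (k - 1) + q * (k - 1)"
          using Suc \<open>s = Suc t\<close> by simp
        have qq: "q \<le> q * (k - 1)" using k_ge_3 by auto
        have sc: "s * c = r * c + c + c" using Suc \<open>s = Suc t\<close> by simp
        \<comment> \<open>Two parts have been gained for the price of a single path, so
          \<open>T\<close>, from which only \<open>r = s - 2\<close> necklaces are due, keeps a
          surplus of nearly \<open>q * (k - 1)\<close> vertices.\<close>
        have cT: "r * (q * (k - 1)) + q * (k - 1) \<le> card T + D + L1 + c"
          using a(10) mq sr less.prems(2) k_ge_3 unfolding c_def by linarith
        have IH: "(\<exists>B. blue_parts B (Suc r) \<and> (\<forall>i\<le>r. B i \<subseteq> T \<and> K \<le> card (B i)))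
           \<or> (\<exists>R a P b m. (\<forall>i<r. necklace (R i) (a i) (P i) (b i) (m i) \<and> R i \<union> P i \<subseteq> T \<and> card (R i) = L1) \<and>
            (\<forall>i<r. \<forall>j<r. i \<noteq> j \<longrightarrow> (R i \<union> P i) \<inter> (R j \<union> P j) = {}) \<and>
            card (T - (\<Union>i<r. R i \<union> P i)) \<le> r * c + K)"
        proof (rule less.IH[of r T 0])
          show "r < s" using Suc \<open>s = Suc t\<close> by simp
          show "r * (q * (k - 1)) \<le> card T + 0" using cT qq sc less.prems(3) by linarith
          show "0 + r * c + (M' + c + L1 + K) < q" using sc less.prems(3) by linarith
        qed (rule TO)
        then show ?thesis
        proof (elim disjE exE conjE)
          fix B assume B: "blue_parts B (Suc r)" "\<forall>i\<le>r. B i \<subseteq> T \<and> K \<le> card (B i)"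
          have h1: "blue_parts (B(Suc r := S')) s"
            using blue_parts_extend[OF B(1) a(9)] B(2) Suc \<open>s = Suc t\<close> by auto
          have h2: "\<forall>i<s. (B(Suc r := S')) i \<subseteq> S' \<union> T \<and> K \<le> card ((B(Suc r := S')) i)"
          proof (intro allI impI)
            fix i assume "i < s"
            then show "(B(Suc r := S')) i \<subseteq> S' \<union> T \<and> K \<le> card ((B(Suc r := S')) i)"
              using B(2)[rule_format, of i] KS Suc \<open>s = Suc t\<close> by (cases "i = Suc r") (simp_all, blast)
          qed
          show ?thesis by (rule two[OF h1 h2])
        next
          \<comment> \<open>The surplus rules this case out: \<open>r\<close> necklaces of at most
            \<open>q * (k - 1)\<close> vertices each would leave it uncovered.\<close>
          fix R a' P' b m' assume R: "\<forall>i<r. necklace (R i) (a' i) (P' i) (b i) (m' i) \<and> R i \<union> P' i \<subseteq> T \<and> card (R i) = L1"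
            and cc: "card (T - (\<Union>i<r. R i \<union> P' i)) \<le> r * c + K"
          have "card T \<le> card (T - (\<Union>i<r. R i \<union> P' i)) + card (\<Union>i<r. R i \<union> P' i)"
            using R necklace_card(1) diff_card_le_card_Diff[of "\<Union>i<r. R i \<union> P' i" T]
            by (metis (no_types, lifting) finite_UN_I finite_lessThan le_diff_conv lessThan_iff)
          also have "card (\<Union>i<r. R i \<union> P' i) \<le> (\<Sum>i<r. card (R i \<union> P' i))" by (rule card_UN_le) simp
          also have "\<dots> \<le> (\<Sum>i<r. q * (k - 1))"
          proof (rule sum_mono)
            fix i assume i: "i \<in> {..<r}"
            then have "R i \<union> P' i \<subseteq> \<Omega>" using R TO by blast
            then show "card (R i \<union> P' i) \<le> q * (k - 1)" using small R i by blast
          qed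
          also have "\<dots> = r * (q * (k - 1))" by simp
          finally have "card T \<le> r * c + K + r * (q * (k - 1))" using cc by linarith
          then show ?thesis using cT qq sc less.prems(3) by linarith
        qed
      qed
    next
      case (b R a P b m S T)
      have TO: "T \<subseteq> \<Omega>" "T \<subseteq> W" "R \<union> P \<subseteq> \<Omega>" using b(2,5) less.prems(1) by blast+
      have sc: "s * c = t * c + c" using Suc by simp
      have ss: "s * (q * (k - 1)) = t * (q * (k - 1)) + q * (k - 1)" using Suc by simp
      have cA: "card (R \<union> P) \<le> q * (k - 1)" using small b TO by blast
      \<comment> \<open>The necklace accounts for at most \<open>q * (k - 1)\<close> vertices; the
        further loss \<open>c\<close> is added to the deficit.\<close>
      have cT: "t * (q * (k - 1)) \<le> card T + (D + c)"
        using b(8) cA ss less.prems(2) unfolding c_def by linarith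
      have IH: "(\<exists>B. blue_parts B (Suc t) \<and> (\<forall>i\<le>t. B i \<subseteq> T \<and> K \<le> card (B i)))
           \<or> (\<exists>R a P b m. (\<forall>i<t. necklace (R i) (a i) (P i) (b i) (m i) \<and> R i \<union> P i \<subseteq> T \<and> card (R i) = L1) \<and>
            (\<forall>i<t. \<forall>j<t. i \<noteq> j \<longrightarrow> (R i \<union> P i) \<inter> (R j \<union> P j) = {}) \<and>
            card (T - (\<Union>i<t. R i \<union> P i)) \<le> t * c + K)"
      proof (rule less.IH[of t T "D + c"])
        show "D + c + t * c + (M' + c + L1 + K) < q" using sc less.prems(3) by linarith
      qed (use Suc TO cT in simp_all)
      then show ?thesis
      proof (elim disjE exE conjE)
        fix B assume B: "blue_parts B (Suc t)" "\<forall>i\<le>t. B i \<subseteq> T \<and> K \<le> card (B i)"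
        have "blue_parts (B(s := S)) (Suc s)" using blue_parts_extend[OF B(1) b(7)] B(2) Suc by auto
        moreover have "\<forall>i\<le>s. (B(s := S)) i \<subseteq> W \<and> K \<le> card ((B(s := S)) i)"
        proof (intro allI impI)
          fix i assume "i \<le> s"
          then show "(B(s := S)) i \<subseteq> W \<and> K \<le> card ((B(s := S)) i)"
            using B(2)[rule_format, of i] b(4,6) L TO(2) Suc by (cases "i = s") (simp_all, blast)
        qed
        ultimately show ?thesis by blast
      next
        fix R' a' P' b' m'
        assume R': "\<forall>i<t. necklace (R' i) (a' i) (P' i) (b' i) (m' i) \<and> R' i \<union> P' i \<subseteq> T \<and> card (R' i) = L1"
          and dis: "\<forall>i<t. \<forall>j<t. i \<noteq> j \<longrightarrow> (R' i \<union> P' i) \<inter> (R' j \<union> P' j) = {}"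
          and cc: "card (T - (\<Union>i<t. R' i \<union> P' i)) \<le> t * c + K"
        let ?R = "R'(t := R)" and ?P = "P'(t := P)" and ?a = "a'(t := a)" and ?b = "b'(t := b)" and ?m = "m'(t := m)"
        have un: "(\<Union>i<s. ?R i \<union> ?P i) = (\<Union>i<t. R' i \<union> P' i) \<union> (R \<union> P)"
          using Suc by (auto simp: less_Suc_eq split: if_splits)
        have A: "\<forall>i<s. necklace (?R i) (?a i) (?P i) (?b i) (?m i) \<and> ?R i \<union> ?P i \<subseteq> W \<and> card (?R i) = L1"
          using R' b(1-3) TO(2) Suc by (auto simp: less_Suc_eq)
        have dT: "(R' i \<union> P' i) \<inter> (R \<union> P) = {}" if "i < t" for i
          using R' b(5) that by blast
        have dis': "\<forall>i<s. \<forall>j<s. i \<noteq> j \<longrightarrow> (?R i \<union> ?P i) \<inter> (?R j \<union> ?P j) = {}"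
        proof (intro allI impI)
          fix i j assume "i < s" "j < s" "i \<noteq> j"
          then show "(?R i \<union> ?P i) \<inter> (?R j \<union> ?P j) = {}"
            using Suc dis dT[of i] dT[of j] by (cases "i = t"; cases "j = t") (simp_all add: Int_commute)
        qed
        let ?A = "\<Union>i<t. R' i \<union> P' i"
        have sub: "?A \<subseteq> T" using R' by blast
        have fA: "finite (\<Union>i<t. R' i \<union> P' i)" "finite (R \<union> P)"
          by (rule finite_subset[OF _ finW], use sub TO(2) b(2) in blast)+
        have "card (W - (?A \<union> (R \<union> P))) = card W - card (?A \<union> (R \<union> P))"
          using fA sub TO b(2) by (intro card_Diff_subset) auto
        moreover have "card (?A \<union> (R \<union> P)) = card ?A + card (R \<union> P)"
          using fA dT by (intro card_Un_disjoint) auto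
        moreover have "card (T - ?A) = card T - card ?A" using fA sub by (intro card_Diff_subset)
        moreover have "card ?A \<le> card T" using sub TO finW by (intro card_mono) (auto intro: finite_subset)
        ultimately have "card (W - (?A \<union> (R \<union> P))) \<le> t * c + K + c"
          using cc b(8) unfolding c_def by linarith
        then have "card (W - (\<Union>i<s. ?R i \<union> ?P i)) \<le> s * c + K" unfolding un sc by simp
        with A dis' show ?thesis by blast
      qed
    qed
  qed
qed

subsection \<open>Absorbing and linking\<close>

text \<open>Without \<open>a\<close>, the clique \<open>R\<close> is a tail for the path
  \<open>P\<close> with end \<open>b\<close>, so \<open>tail_exit\<close> applies.\<close>

lemma necklace_exit:
  assumes N: "necklace R a P b m" and R: "card e + k < card R"
    and e: "finite e" "e \<inter> P = {}" "z \<in> e \<inter> R"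
  obtains g where "g \<subseteq> R" "lpath a (P \<union> g) z (m + 1)" "(P \<union> g) \<inter> e = {z}" "card g = k" "b \<in> g"
proof -
  note N' = N[unfolded necklace_def]
  have 1: "P \<inter> (R - {a}) = {b}" using N' by blast
  have 2: "red_clique (R - {a})" using N' red_clique_subset by blast
  have "a \<in> R" "finite R" using N' by (auto simp: red_clique_def)
  then have 3: "card e + k \<le> card (R - {a})" using R by simp
  have 4: "z \<in> e \<inter> (R - {a})" using e N' by blast
  have 5: "lpath a P b m" using N' by blast
  obtain g where "g \<subseteq> R - {a}" "lpath a (P \<union> g) z (m + 1)" "(P \<union> g) \<inter> e = {z}" "card g = k" "b \<in> g"
    by (rule tail_exit[OF 5 1 2 3 e(1,2) 4])
  then show ?thesis using that[of g] by blast
qed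

text \<open>When the path is prolonged to another vertex \<open>c\<close> of \<open>R\<close>, the
  clique gives up the vertices that the path now uses, except for the two ends. The union loses
  nothing, and the loss of the clique is confined to \<open>X\<close>, which contains
  \<open>b\<close> because the old end may leave as well.\<close>

lemma necklace_shift:
  assumes N: "necklace R a P b m" and P': "lpath a P' c m'" "P \<subseteq> P'" "P' \<subseteq> P \<union> X"
    and c: "a \<noteq> c" "c \<in> R" and X: "finite X" "b \<in> X"
  shows "necklace ((R - P') \<union> {a, c}) a P' c m'" "((R - P') \<union> {a, c}) \<union> P' = R \<union> P'"
    "(R - P') \<union> {a, c} \<subseteq> R" "card R \<le> card ((R - P') \<union> {a, c}) + card X"
proof -
  note N' = N[unfolded necklace_def]
  have a: "a \<in> R" "a \<in> P'" "c \<in> P'" using N' lpath_props[OF P'(1)] by auto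
  show sub: "(R - P') \<union> {a, c} \<subseteq> R" using a c by blast
  have "red_clique ((R - P') \<union> {a, c})" using N' sub red_clique_subset by blast
  then show "necklace ((R - P') \<union> {a, c}) a P' c m'"
    using P'(1) c a unfolding necklace_def by auto
  show "((R - P') \<union> {a, c}) \<union> P' = R \<union> P'" using a c by blast
  have "finite R" using N' by (simp add: red_clique_def)
  moreover have "R \<subseteq> ((R - P') \<union> {a, c}) \<union> X"
    using P'(3) N' X(2) by blast
  ultimately have "card R \<le> card (((R - P') \<union> {a, c}) \<union> X)"
    using X(1) by (intro card_mono) auto
  then show "card R \<le> card ((R - P') \<union> {a, c}) + card X"
    using card_Un_le[of "(R - P') \<union> {a, c}" X] by linarith
qed

text \<open>The path enters \<open>e\<close> at \<open>z\<close> and leaves it at \<open>z'\<close>.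
  Both are in the clique, so the result is again a necklace, now containing all of
  \<open>e\<close>.\<close>

lemma necklace_absorb_edge:
  assumes N: "necklace R a P b m" and R: "2 * k < card R"
    and e: "red e" "card e = k" "e \<inter> P = {}" "z \<in> e \<inter> R" "z' \<in> e \<inter> R" "z \<noteq> z'"
  obtains R' P' c m' where "necklace R' a P' c m'" "R' \<union> P' = R \<union> P \<union> e" "R' \<subseteq> R"
    "card R \<le> card R' + 3 * k"
proof -
  note N' = N[unfolded necklace_def]
  have fe: "finite e" using finite_edge e(2) by blast
  have sz: "card e + k < card R" using R e(2) by simp
  obtain g where g: "g \<subseteq> R" "lpath a (P \<union> g) z (m + 1)" "(P \<union> g) \<inter> e = {z}" "card g = k" "b \<in> g"
    by (rule necklace_exit[OF N sz fe e(3,4)])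
  have 1: "lpath a (P \<union> g \<union> e) z' (Suc (m + 1))"
    using lpath_snoc[OF g(2) e(1,2)] g(3) e(5,6) by (simp add: Int_commute)
  have az: "a \<noteq> z'" "z' \<in> R" using e(3,5) N' by blast+
  have sub: "P \<subseteq> P \<union> g \<union> e" "P \<union> g \<union> e \<subseteq> P \<union> (g \<union> e)" by blast+
  have X: "finite (g \<union> e)" "b \<in> g \<union> e" using fe finite_edge g by auto
  note S = necklace_shift[OF N 1 sub az X]
  have "card (g \<union> e) \<le> 3 * k" using card_Un_le[of g e] g e by simp
  then have "card R \<le> card ((R - (P \<union> g \<union> e)) \<union> {a, z'}) + 3 * k" using S(4) by linarith
  moreover have "R \<union> (P \<union> g \<union> e) = R \<union> P \<union> e" using g by blast
  ultimately show ?thesis using that[OF S(1)] S(2,3) by simp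
qed

text \<open>Two edges with one clique vertex each are absorbed as one detour: from \<open>v\<close>
  along \<open>e\<close> to \<open>y\<close>, then along \<open>f\<close> back to \<open>w\<close>
  in the clique. The \<open>3 * k\<close> allows for \<open>e\<close>, \<open>f\<close> and the edge
  \<open>g\<close> that leads to \<open>v\<close>.\<close>

lemma necklace_absorb_two_edges:
  assumes N: "necklace R a P b m" and R: "3 * k < card R"
    and e: "red e" "card e = k" "e \<inter> P = {}" "e \<inter> R = {v}"
    and f: "red f" "card f = k" "f \<inter> P = {}" "f \<inter> R = {w}"
    and ef: "e \<inter> f = {y}" "v \<noteq> w"
  obtains R' P' c m' where "necklace R' a P' c m'" "R' \<union> P' = R \<union> P \<union> (e \<union> f)" "R' \<subseteq> R"
    "card R \<le> card R' + 3 * k"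
proof -
  note N' = N[unfolded necklace_def]
  have fin: "finite e" "finite f" using finite_edge e(2) f(2) by blast+
  have sz: "card (e \<union> f) + k < card R" using card_Un_le[of e f] e(2) f(2) R by simp
  have hits: "finite (e \<union> f)" "(e \<union> f) \<inter> P = {}" "v \<in> (e \<union> f) \<inter> R" using fin e(3,4) f(3) by auto
  obtain g where g: "g \<subseteq> R" "lpath a (P \<union> g) v (m + 1)" "(P \<union> g) \<inter> (e \<union> f) = {v}" "card g = k" "b \<in> g"
    by (rule necklace_exit[OF N sz hits])
  have vf: "v \<notin> f" "v \<in> e" "w \<in> f" using e(4) f(4) ef(2) by blast+
  have y: "y \<in> e" "y \<in> f" using ef(1) by auto
  have yv: "y \<noteq> v" using y vf by auto
  have "w \<in> R" "w \<notin> e" using e(4) f(4) ef(2) by auto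
  then have wy: "w \<noteq> y" using y by auto
  have "e \<inter> (P \<union> g) = {v}" using g(3) vf by blast
  from lpath_snoc[OF g(2) e(1,2) this y(1) yv]
  have 1: "lpath a (P \<union> g \<union> e) y (Suc (m + 1))" .
  have "f \<inter> (P \<union> g \<union> e) = {y}" using g(3) vf ef(1) by blast
  from lpath_snoc[OF 1 f(1,2) this vf(3) wy]
  have 2: "lpath a (P \<union> g \<union> e \<union> f) w (Suc (Suc (m + 1)))" .
  have aw: "a \<noteq> w" "w \<in> R" using f(3,4) vf(3) N' by blast+
  have sub: "P \<subseteq> P \<union> g \<union> e \<union> f" "P \<union> g \<union> e \<union> f \<subseteq> P \<union> (g \<union> e \<union> f)" by blast+
  have X: "finite (g \<union> e \<union> f)" "b \<in> g \<union> e \<union> f" using fin finite_edge g by auto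
  note S = necklace_shift[OF N 2 sub aw X]
  have "card (g \<union> e \<union> f) \<le> 3 * k" using card_Un_le[of "g \<union> e" f] card_Un_le[of g e] g e f by simp
  then have "card R \<le> card ((R - (P \<union> g \<union> e \<union> f)) \<union> {a, w}) + 3 * k" using S(4) by linarith
  moreover have "R \<union> (P \<union> g \<union> e \<union> f) = R \<union> P \<union> (e \<union> f)" using g by blast
  ultimately show ?thesis using that[OF S(1)] S(2,3) by simp
qed

text \<open>The path runs along one necklace, across \<open>e\<close>, and back along the other; the
  \<open>3\<close> extra edges are \<open>e\<close> and one edge in either clique. It is too long as
  soon as \<open>m + m'\<close> is at least \<open>q\<close>.\<close>

lemma necklaces_link_edge:
  assumes N: "necklace R a P b m" "necklace R' a' P' b' m'" and R: "2 * k < card R" "2 * k < card R'"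
    and dis: "(R \<union> P) \<inter> (R' \<union> P') = {}"
    and e: "red e" "card e = k" "e \<inter> P = {}" "e \<inter> P' = {}" "z \<in> e \<inter> R" "z' \<in> e \<inter> R'"
  obtains Q where "lpath a Q a' (m + m' + 3)" "Q \<subseteq> (R \<union> P) \<union> (R' \<union> P') \<union> e"
proof -
  have fe: "finite e" using finite_edge e(2) by blast
  have sz: "card e + k < card R" "card e + k < card R'" using R e(2) by simp_all
  obtain g where g: "g \<subseteq> R" "lpath a (P \<union> g) z (m + 1)" "(P \<union> g) \<inter> e = {z}"
    using necklace_exit[OF N(1) sz(1) fe e(3,5)] by blast
  obtain g' where g': "g' \<subseteq> R'" "lpath a' (P' \<union> g') z' (m' + 1)" "(P' \<union> g') \<inter> e = {z'}"
    using necklace_exit[OF N(2) sz(2) fe e(4,6)] by blast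
  have "z' \<noteq> z" using e dis by blast
  then have 1: "lpath a (P \<union> g \<union> e) z' (Suc (m + 1))"
    using lpath_snoc[OF g(2) e(1,2)] g(3) e(6) by (simp add: Int_commute)
  have "(P \<union> g \<union> e) \<inter> (P' \<union> g') = {z'}" using g(1) g'(1,3) dis by blast
  from lpath_append[OF lpath_rev[OF g'(2)] 1 this]
  have "lpath a ((P \<union> g \<union> e) \<union> (P' \<union> g')) a' (m + m' + 3)" by (simp add: numeral_3_eq_3)
  moreover have "(P \<union> g \<union> e) \<union> (P' \<union> g') \<subseteq> (R \<union> P) \<union> (R' \<union> P') \<union> e" using g(1) g'(1) by blast
  ultimately show ?thesis using that by blast
qed

text \<open>Here the connection passes through the common vertex \<open>y\<close> of two edges,
  which makes \<open>4\<close> extra edges.\<close>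

lemma necklaces_link_two_edges:
  assumes N: "necklace R a P b m" "necklace R' a' P' b' m'" and R: "2 * k < card R" "2 * k < card R'"
    and dis: "(R \<union> P) \<inter> (R' \<union> P') = {}"
    and e: "red e" "card e = k" "e \<inter> P = {}" "e \<inter> (R' \<union> P') = {}" "z \<in> e \<inter> R"
    and f: "red f" "card f = k" "f \<inter> P' = {}" "f \<inter> (R \<union> P) = {}" "z' \<in> f \<inter> R'"
    and y: "e \<inter> f = {y}"
  obtains Q where "lpath a Q a' (m + m' + 4)" "Q \<subseteq> (R \<union> P) \<union> (R' \<union> P') \<union> (e \<union> f)"
proof -
  have fin: "finite e" "finite f" using finite_edge e(2) f(2) by blast+
  have sz: "card e + k < card R" "card f + k < card R'" using R e(2) f(2) by simp_all
  obtain g where g: "g \<subseteq> R" "lpath a (P \<union> g) z (m + 1)" "(P \<union> g) \<inter> e = {z}"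
    using necklace_exit[OF N(1) sz(1) fin(1) e(3,5)] by blast
  obtain g' where g': "g' \<subseteq> R'" "lpath a' (P' \<union> g') z' (m' + 1)" "(P' \<union> g') \<inter> f = {z'}"
    using necklace_exit[OF N(2) sz(2) fin(2) f(3,5)] by blast
  have yz: "y \<in> e" "y \<in> f" "y \<noteq> z" "y \<noteq> z'" using y e f by blast+
  have "e \<inter> (P \<union> g) = {z}" using g(3) by blast
  from lpath_snoc[OF g(2) e(1,2) this yz(1,3)]
  have 1: "lpath a (P \<union> g \<union> e) y (Suc (m + 1))" .
  have "f \<inter> (P' \<union> g') = {z'}" using g'(3) by blast
  from lpath_snoc[OF g'(2) f(1,2) this yz(2,4)]
  have 2: "lpath a' (P' \<union> g' \<union> f) y (Suc (m' + 1))" .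
  have "P \<inter> (P' \<union> g' \<union> f) = {}" "g \<inter> (P' \<union> g' \<union> f) = {}" using g(1) g'(1) dis f(4) by blast+
  moreover have "e \<inter> (P' \<union> g' \<union> f) = {y}" using g'(1) e(4) y by blast
  ultimately have "(P \<union> g \<union> e) \<inter> (P' \<union> g' \<union> f) = {y}" by (simp add: Int_Un_distrib2)
  from lpath_append[OF lpath_rev[OF 2] 1 this]
  have "lpath a ((P \<union> g \<union> e) \<union> (P' \<union> g' \<union> f)) a' (m + m' + 4)" by (simp add: eval_nat_numeral)
  moreover have "(P \<union> g \<union> e) \<union> (P' \<union> g' \<union> f) \<subseteq> (R \<union> P) \<union> (R' \<union> P') \<union> (e \<union> f)" using g(1) g'(1) by blast
  ultimately show ?thesis using that by blast
qed

text \<open>A path through \<open>R\<close> from \<open>b\<close> ends at \<open>v\<close> and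
  continues along \<open>e\<close>, whose other \<open>k - 1\<close> vertices lie outside the
  necklace. This is why the size required of the necklace drops by \<open>k - 1\<close>.\<close>

lemma necklace_path_one_end:
  assumes N: "necklace R a P b m" and R: "2 * k < card R"
    and c: "q * (k - 1) + 1 \<le> card (R \<union> P) + (k - 1)"
    and e: "red e" "card e = k" "e \<inter> P = {}" "e \<inter> R = {v}"
  obtains x Q y where "lpath x Q y q" "Q \<subseteq> R \<union> P \<union> e"
proof -
  note N' = N[unfolded necklace_def]
  have fR: "finite R" using N' by (simp add: red_clique_def)
  have ab: "a \<in> R" "b \<in> R" "a \<in> P" "b \<in> P" using N' by auto
  have v: "v \<in> R" "v \<in> e" "v \<noteq> a" "v \<noteq> b" using e ab by blast+
  \<comment> \<open>One of the \<open>q\<close> edges is \<open>e\<close>; the maximum with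
    \<open>1\<close> provides the edge needed to get from \<open>b\<close> to \<open>v\<close>
    inside the clique.\<close>
  define j where "j = max 1 (q - 1 - m)"
  have "j * (k - 1) + 1 \<le> card (R - {a})"
  proof (cases "q - 1 - m \<le> 1")
    case True
    then show ?thesis using R fR ab k_ge_3 by (simp add: j_def max_def)
  next
    case False
    then have j: "q = m + j + 1" by (simp add: j_def max_def)
    show ?thesis using c necklace_card(2)[OF N] ab fR unfolding j by (simp add: add_mult_distrib)
  qed
  moreover have "1 \<le> j" by (simp add: j_def)
  ultimately obtain Q where Q: "Q \<subseteq> R - {a}" "lpath b Q v j"
    using red_clique_path[of "R - {a}" j b v] red_clique_subset[of R "R - {a}"] ab v N' by auto
  have "b \<in> Q" "v \<in> Q" using lpath_props[OF Q(2)] by blast+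
  then have "P \<inter> Q = {b}" using Q(1) N' by blast
  then have 1: "lpath a (P \<union> Q) v (m + j)" using lpath_append[OF Q(2)] N' by blast
  have "card (e - {v}) \<noteq> 0" using e(2) v(2) k_ge_3 finite_edge by simp
  then have "e - {v} \<noteq> {}" by (metis card.empty)
  then obtain y where y: "y \<in> e" "y \<noteq> v" by blast
  have "e \<inter> (P \<union> Q) = {v}" using e(3,4) Q(1) \<open>v \<in> Q\<close> v(2) by blast
  from lpath_snoc[OF 1 e(1,2) this y] have "lpath a (P \<union> Q \<union> e) y (Suc (m + j))" .
  moreover have "q \<le> Suc (m + j)" unfolding j_def by linarith
  ultimately obtain P' b' where "P' \<subseteq> P \<union> Q \<union> e" "lpath a P' b' q"
    using lpath_prefix[of a "P \<union> Q \<union> e" y "Suc (m + j)" q] by auto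
  moreover have "P \<union> Q \<union> e \<subseteq> R \<union> P \<union> e" using Q(1) by blast
  ultimately show ?thesis using that by blast
qed

text \<open>Both ends of \<open>P\<close> are prolonged: from \<open>b\<close> by a single edge
  \<open>g\<close> to \<open>v\<close> and on along \<open>e\<close>, from \<open>a\<close> by a
  path \<open>Q\<close> in the remaining clique to \<open>w\<close> and on along \<open>f\<close>.
  Together \<open>e\<close> and \<open>f\<close> contribute \<open>2 * (k - 1)\<close> vertices
  outside the necklace.\<close>

lemma necklace_path_two_ends:
  assumes N: "necklace R a P b m" and R: "3 * k < card R"
    and c: "q * (k - 1) + 1 \<le> card (R \<union> P) + 2 * (k - 1)"
    and e: "red e" "card e = k" "e \<inter> P = {}" "e \<inter> R = {v}"
    and f: "red f" "card f = k" "f \<inter> P = {}" "f \<inter> R = {w}"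
    and ef: "e \<inter> f = {}"
  obtains x Q y where "lpath x Q y q" "Q \<subseteq> R \<union> P \<union> (e \<union> f)"
proof -
  note N' = N[unfolded necklace_def]
  have fR: "finite R" using N' by (simp add: red_clique_def)
  have ab: "a \<in> R" "b \<in> R" "a \<in> P" "b \<in> P" "a \<noteq> b" using N' by auto
  have v: "v \<in> R" "v \<in> e" "v \<noteq> a" "v \<noteq> b" "v \<noteq> w" using e f ef ab by blast+
  have w: "w \<in> R" "w \<in> f" "w \<noteq> a" "w \<noteq> b" using f ab by blast+
  have "card {a, w} + k \<le> card R" using R w k_ge_3 by auto
  then obtain g where g: "g \<subseteq> R" "lpath b g v 1" "card g = k" "g \<inter> {a, w} \<subseteq> {b, v}"
    using red_clique_edge[of R "{a, w}" b v] N' ab v by auto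
  have gv: "b \<in> g" "v \<in> g" "a \<notin> g" "w \<notin> g" using lpath_props[OF g(2)] g(4) ab v w by auto
  \<comment> \<open>The \<open>3\<close> edges apart from those of \<open>P\<close> and
    \<open>Q\<close> are \<open>e\<close>, \<open>f\<close> and \<open>g\<close>; \<open>Q\<close>
    needs at least one edge to lead from \<open>a\<close> to \<open>w\<close>.\<close>
  define j where "j = max 1 (q - 3 - m)"
  have cg: "card (R - g) = card R - k" using g fR by (simp add: card_Diff_subset finite_subset)
  have "j * (k - 1) + 1 \<le> card (R - g)"
  proof (cases "q - 3 - m \<le> 1")
    case True
    then show ?thesis using R cg k_ge_3 by (simp add: j_def max_def)
  next
    case False
    then have j: "q = m + j + 3" by (simp add: j_def max_def)
    have "(m + j + 3) * (k - 1) = m * (k - 1) + j * (k - 1) + 3 * (k - 1)" by (simp add: add_mult_distrib)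
    then show ?thesis using c necklace_card(2)[OF N] cg k_ge_3 unfolding j by linarith
  qed
  moreover have "1 \<le> j" by (simp add: j_def)
  ultimately obtain Q where Q: "Q \<subseteq> R - g" "lpath a Q w j"
    using red_clique_path[of "R - g" j a w] red_clique_subset[of R "R - g"] ab w gv N' by auto
  have qa: "a \<in> Q" "w \<in> Q" using lpath_props[OF Q(2)] by blast+
  have PR: "P \<inter> R = {a, b}" using N' by blast
  then have "P \<inter> g = {b}" using g(1) gv ab(4) by auto
  then have 1: "lpath a (P \<union> g) v (m + 1)" using lpath_append[OF g(2)] N' by blast
  have "card (e - {v}) \<noteq> 0" using e(2) v(2) k_ge_3 finite_edge by simp
  then have "e - {v} \<noteq> {}" by (metis card.empty)
  then obtain y where y: "y \<in> e" "y \<noteq> v" by blast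
  have "card (f - {w}) \<noteq> 0" using f(2) w(2) k_ge_3 finite_edge by simp
  then have "f - {w} \<noteq> {}" by (metis card.empty)
  then obtain x where x: "x \<in> f" "x \<noteq> w" by blast
  have "e \<inter> (P \<union> g) = {v}" using e(3,4) g(1) gv(2) v(2) by auto
  from lpath_snoc[OF 1 e(1,2) this y] have 2: "lpath a (P \<union> g \<union> e) y (Suc (m + 1))" .
  have "f \<inter> Q = {w}" using f(4) Q(1) qa(2) w(2) by auto
  from lpath_snoc[OF Q(2) f(1,2) this x] have 3: "lpath a (Q \<union> f) x (Suc j)" .
  have "P \<inter> (Q \<union> f) = {a}" using PR Q(1) gv(1) qa(1) ab(3) f(3) by auto
  moreover have "g \<inter> (Q \<union> f) = {}" using Q(1) f(4) g(1) gv(4) by auto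
  moreover have "e \<inter> (Q \<union> f) = {}" using Q(1) e(4) gv(2) ef by auto
  ultimately have "(P \<union> g \<union> e) \<inter> (Q \<union> f) = {a}" by (simp add: Int_Un_distrib2)
  then have "(Q \<union> f) \<inter> (P \<union> g \<union> e) = {a}" by (simp only: Int_commute)
  from lpath_append[OF 2 lpath_rev[OF 3] this]
  have "lpath x ((Q \<union> f) \<union> (P \<union> g \<union> e)) y (Suc j + Suc (m + 1))" .
  moreover have "q \<le> Suc j + Suc (m + 1)" unfolding j_def by linarith
  ultimately obtain P' b' where "P' \<subseteq> (Q \<union> f) \<union> (P \<union> g \<union> e)" "lpath x P' b' q"
    using lpath_prefix[of x "(Q \<union> f) \<union> (P \<union> g \<union> e)" y "Suc j + Suc (m + 1)" q] by auto
  moreover have "(Q \<union> f) \<union> (P \<union> g \<union> e) \<subseteq> R \<union> P \<union> (e \<union> f)" using Q(1) g(1) by blast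
  ultimately show ?thesis using that by blast
qed

subsection \<open>The extremal family of necklaces\<close>

text \<open>Absorbing at least one vertex of the uncovered set costs a clique at most \<open>3 * k\<close> vertices,
  which the lower bound on \<open>card (R i)\<close> accounts for.\<close>

definition necklaces :: "'v set \<Rightarrow> nat \<Rightarrow> nat \<Rightarrow> nat \<Rightarrow> (nat \<Rightarrow> 'v set) \<Rightarrow> (nat \<Rightarrow> 'v) \<Rightarrow>
    (nat \<Rightarrow> 'v set) \<Rightarrow> (nat \<Rightarrow> 'v) \<Rightarrow> (nat \<Rightarrow> nat) \<Rightarrow> bool" where
  "necklaces \<Omega> J L1 s R a P b m \<longleftrightarrow>
     (\<forall>i<s. necklace (R i) (a i) (P i) (b i) (m i) \<and> R i \<union> P i \<subseteq> \<Omega> \<and> card (R i) \<le> L1 \<and>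
        J + 3 * k * card (\<Omega> - (\<Union>i<s. R i \<union> P i)) \<le> card (R i)) \<and>
     (\<forall>i<s. \<forall>j<s. i \<noteq> j \<longrightarrow> (R i \<union> P i) \<inter> (R j \<union> P j) = {})"

text \<open>The uncovered set shrinks, so the lower bound on clique sizes falls by at least the
  \<open>3 * k\<close> vertices that the clique may lose. A family with fewest uncovered vertices
  thus admits no absorption.\<close>

lemma necklaces_absorb:
  assumes fin: "finite \<Omega>" and N: "necklaces \<Omega> J L1 s R a P b m" and i: "i < s"
    and new: "necklace R' a' P' b' m'" "R' \<union> P' = R i \<union> P i \<union> F" "R' \<subseteq> R i" "card (R i) \<le> card R' + 3 * k"
    and F: "F \<subseteq> (R i \<union> P i) \<union> (\<Omega> - (\<Union>i<s. R i \<union> P i))" "F \<inter> (\<Omega> - (\<Union>i<s. R i \<union> P i)) \<noteq> {}"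
  shows "necklaces \<Omega> J L1 s (R(i := R')) (a(i := a')) (P(i := P')) (b(i := b')) (m(i := m')) \<and>
     card (\<Omega> - (\<Union>j<s. (R(i := R')) j \<union> (P(i := P')) j)) < card (\<Omega> - (\<Union>i<s. R i \<union> P i))"
proof -
  let ?X = "\<Omega> - (\<Union>i<s. R i \<union> P i)" and ?X' = "\<Omega> - (\<Union>j<s. (R(i := R')) j \<union> (P(i := P')) j)"
  note N' = N[unfolded necklaces_def]
  have N1: "necklace (R j) (a j) (P j) (b j) (m j)" "R j \<union> P j \<subseteq> \<Omega>" "card (R j) \<le> L1"
    "J + 3 * k * card ?X \<le> card (R j)" if "j < s" for j
    using N' that by simp_all
  have N2: "(R j \<union> P j) \<inter> (R l \<union> P l) = {}" if "j < s" "l < s" "j \<noteq> l" for j l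
    using N' that by simp
  have un: "(\<Union>j<s. (R(i := R')) j \<union> (P(i := P')) j) = (\<Union>j<s. R j \<union> P j) \<union> F"
  proof (intro equalityI subsetI)
    fix x assume "x \<in> (\<Union>j<s. (R(i := R')) j \<union> (P(i := P')) j)"
    then obtain j where "j < s" "x \<in> (R(i := R')) j \<union> (P(i := P')) j" by blast
    then show "x \<in> (\<Union>j<s. R j \<union> P j) \<union> F" using new(2) i by (cases "j = i") auto
  next
    fix x assume "x \<in> (\<Union>j<s. R j \<union> P j) \<union> F"
    then consider j where "j < s" "j \<noteq> i" "x \<in> R j \<union> P j" | "x \<in> R i \<union> P i \<union> F" by blast
    then show "x \<in> (\<Union>j<s. (R(i := R')) j \<union> (P(i := P')) j)"
    proof cases
      case (1 j)
      then have "x \<in> (R(i := R')) j \<union> (P(i := P')) j" by simp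
      then show ?thesis using 1(1) by blast
    next
      case 2
      then have "x \<in> (R(i := R')) i \<union> (P(i := P')) i" using new(2) by simp
      then show ?thesis using i by blast
    qed
  qed
  have "?X' \<subset> ?X" using F(2) unfolding un by blast
  then have lt: "card ?X' < card ?X" using fin by (intro psubset_card_mono) auto
  then have "3 * k * Suc (card ?X') \<le> 3 * k * card ?X" by (intro mult_le_mono) auto
  then have J: "J + 3 * k * card ?X' + 3 * k \<le> J + 3 * k * card ?X" by simp
  have fR: "finite (R i)" using N1(1)[OF i] by (simp add: necklace_def red_clique_def)
  have A: "necklace ((R(i := R')) j) ((a(i := a')) j) ((P(i := P')) j) ((b(i := b')) j) ((m(i := m')) j) \<and>
      (R(i := R')) j \<union> (P(i := P')) j \<subseteq> \<Omega> \<and> card ((R(i := R')) j) \<le> L1 \<and>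
      J + 3 * k * card ?X' \<le> card ((R(i := R')) j)" if j: "j < s" for j
  proof (cases "j = i")
    case True
    have "F \<subseteq> \<Omega>" using F(1) N1(2)[OF i] by blast
    then have "R' \<union> P' \<subseteq> \<Omega>" using new(2) N1(2)[OF i] by simp
    moreover have "card R' \<le> L1" using N1(3)[OF i] card_mono[OF fR new(3)] by linarith
    moreover have "J + 3 * k * card ?X' \<le> card R'" using N1(4)[OF i] J new(4) by linarith
    ultimately show ?thesis using True new(1) by simp
  next
    case False
    then show ?thesis using N1[OF j] J by simp
  qed
  have FA: "(R i \<union> P i \<union> F) \<inter> (R j \<union> P j) = {}" if "j < s" "j \<noteq> i" for j
    using N2[OF i that(1)] that F(1) by blast
  have B: "((R(i := R')) j \<union> (P(i := P')) j) \<inter> ((R(i := R')) l \<union> (P(i := P')) l) = {}"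
    if jl: "j < s" "l < s" "j \<noteq> l" for j l
  proof -
    consider "j = i" "l \<noteq> i" | "j \<noteq> i" "l = i" | "j \<noteq> i" "l \<noteq> i" using jl by blast
    then show ?thesis
    proof cases
      case 1
      then show ?thesis using FA[of l] jl new(2) by simp
    next
      case 2
      then show ?thesis using FA[of j] jl new(2) by (simp add: Int_commute)
    next
      case 3
      then show ?thesis using N2[OF jl] by simp
    qed
  qed
  show ?thesis unfolding necklaces_def using A B lt by simp
qed

lemma necklaces_minimal:
  assumes "necklaces \<Omega> J L1 s R a P b m"
  obtains R a P b m where "necklaces \<Omega> J L1 s R a P b m"
    "\<And>R' a' P' b' m'. necklaces \<Omega> J L1 s R' a' P' b' m' \<Longrightarrow>
       card (\<Omega> - (\<Union>i<s. R i \<union> P i)) \<le> card (\<Omega> - (\<Union>i<s. R' i \<union> P' i))"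
proof -
  define good where "good = (\<lambda>(R, a, P, b, m). necklaces \<Omega> J L1 s R a P b m)"
  define meas where "meas = (\<lambda>(R :: nat \<Rightarrow> 'v set, a :: nat \<Rightarrow> 'v, P :: nat \<Rightarrow> 'v set, b :: nat \<Rightarrow> 'v, m :: nat \<Rightarrow> nat).
    card (\<Omega> - (\<Union>i<s. R i \<union> P i)))"
  have "good (R, a, P, b, m)" using assms by (simp add: good_def)
  then obtain x where x: "good x" "\<forall>y. good y \<longrightarrow> meas x \<le> meas y"
    using ex_has_least_nat[of good _ meas] by blast
  obtain R1 a1 P1 b1 m1 where xe: "x = (R1, a1, P1, b1, m1)" by (metis surj_pair)
  show ?thesis
  proof (rule that)
    show "necklaces \<Omega> J L1 s R1 a1 P1 b1 m1" using x(1) by (simp add: xe good_def)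
    fix R' a' P' b' m' assume "necklaces \<Omega> J L1 s R' a' P' b' m'"
    then have "good (R', a', P', b', m')" by (simp add: good_def)
    then show "card (\<Omega> - (\<Union>i<s. R1 i \<union> P1 i)) \<le> card (\<Omega> - (\<Union>i<s. R' i \<union> P' i))"
      using x(2)[rule_format, of "(R', a', P', b', m')"] by (simp add: xe meas_def)
  qed
qed

text \<open>The two alternatives belong to the two terms of the maximum in the final bound. In the
  condition on \<open>J\<close>, \<open>2 ^ C\<close> pays for one discarded clique vertex per
  subset of the uncovered set, \<open>2\<close> for the ends \<open>a i\<close> and
  \<open>b i\<close>, and \<open>K\<close> for the size a part must keep.\<close>

lemma card_bound:
  fixes J L1 K C q s \<sigma> \<tau> :: nat
  assumes fin: "finite \<Omega>"
    and N0: "necklaces \<Omega> J L1 s R0 a0 P0 b0 m0" "card (\<Omega> - (\<Union>i<s. R0 i \<union> P0 i)) \<le> C"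
    and J: "K + 2 + 2 ^ C + 3 * k < J"
    and q: "2 * (C + L1) \<le> q" "s * (q * (k - 1)) \<le> card \<Omega>"
    and no_path: "\<And>a P b. lpath a P b q \<Longrightarrow> \<not> P \<subseteq> \<Omega>"
    and no_blue: "\<And>B. blue_parts B (Suc s) \<Longrightarrow> \<forall>i\<le>s. B i \<subseteq> \<Omega> \<Longrightarrow> \<forall>i<s. K \<le> card (B i) \<Longrightarrow> card (B s) < \<sigma>"
    and tau: "\<And>X F. X \<subseteq> \<Omega> \<Longrightarrow> \<tau> < card X \<Longrightarrow> \<forall>f\<in>F. f \<subseteq> X \<and> card f = k - 1 \<Longrightarrow>
        \<forall>f\<in>F. \<forall>g\<in>F. f \<noteq> g \<longrightarrow> card (f \<inter> g) \<noteq> 1 \<Longrightarrow> \<exists>Z\<subseteq>X. \<sigma> \<le> card Z \<and> (\<forall>f\<in>F. \<not> f \<subseteq> Z)"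
  shows "card \<Omega> < s * (q * (k - 1)) + \<sigma> \<or> card \<Omega> + 2 * (k - 1) \<le> s * (q * (k - 1)) + \<tau>"
proof -
  obtain R a P b m where N: "necklaces \<Omega> J L1 s R a P b m"
    and minimal: "\<And>R' a' P' b' m'. necklaces \<Omega> J L1 s R' a' P' b' m' \<Longrightarrow>
       card (\<Omega> - (\<Union>i<s. R i \<union> P i)) \<le> card (\<Omega> - (\<Union>i<s. R' i \<union> P' i))"
    using necklaces_minimal[OF N0(1)] by blast
  define A where "A i = R i \<union> P i" for i
  define X where "X = \<Omega> - (\<Union>i<s. A i)"
  have X0: "X = \<Omega> - (\<Union>i<s. R i \<union> P i)" by (simp add: X_def A_def)
  have finX: "finite X" and XO: "X \<subseteq> \<Omega>" using fin by (auto simp: X_def)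
  have cX: "card X \<le> C" using minimal[OF N0(1)] N0(2) unfolding X0 by linarith
  have N1: "necklace (R i) (a i) (P i) (b i) (m i)" "A i \<subseteq> \<Omega>" "card (R i) \<le> L1" "J \<le> card (R i)" if "i < s" for i
    using N[unfolded necklaces_def, THEN conjunct1, rule_format, OF that] unfolding A_def by auto
  have dis: "A i \<inter> A j = {}" if "i < s" "j < s" "i \<noteq> j" for i j
    using N[unfolded necklaces_def, THEN conjunct2, rule_format, OF that] unfolding A_def .
  have XA: "X \<inter> A i = {}" if "i < s" for i using that by (auto simp: X_def)
  have AO: "R i \<union> P i \<subseteq> \<Omega>" if "i < s" for i using N1(2)[OF that] by (simp add: A_def)
  have finA: "finite (A i)" if "i < s" for i using N1(2)[OF that] fin finite_subset by blast
  have big: "3 * k < card (R i)" if "i < s" for i using N1(4)[OF that] J by linarith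
  have big2: "2 * k < card (R i)" if "i < s" for i using big[OF that] by linarith
  have PR: "P i \<inter> R i = {a i, b i}" if "i < s" for i using N1(1)[OF that] by (simp add: necklace_def)
  have no_long: "n < q" if l: "lpath x Q y n" "Q \<subseteq> \<Omega>" for x Q y n
  proof (rule ccontr)
    assume "\<not> n < q"
    then obtain Q' y' where "Q' \<subseteq> Q" "lpath x Q' y' q" using lpath_prefix[OF l(1), of q] by auto
    then show False using no_path[of x Q' y'] l(2) by blast
  qed
  have cA: "card (A i) \<le> q * (k - 1)" if i: "i < s" for i
  proof (rule ccontr)
    assume "\<not> card (A i) \<le> q * (k - 1)"
    then have "q * (k - 1) + 1 \<le> card (R i \<union> P i)" by (simp add: A_def)
    moreover have "3 \<le> card (R i)" using big[OF i] k_ge_3 by linarith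
    ultimately obtain Q x where "lpath (a i) Q x q" "Q \<subseteq> R i \<union> P i"
      using necklace_path[OF N1(1)[OF i]] by blast
    then show False using no_path N1(2)[OF i] unfolding A_def by blast
  qed
  have total: "card \<Omega> = card X + (\<Sum>i<s. card (A i))"
  proof -
    have sub: "(\<Union>i<s. A i) \<subseteq> \<Omega>" using N1(2) by blast
    have "card \<Omega> = card X + card (\<Union>i<s. A i)"
      unfolding X_def using card_Diff_subset[OF finite_subset[OF sub fin] sub] card_mono[OF fin sub] by linarith
    also have "card (\<Union>i<s. A i) = (\<Sum>i<s. card (A i))"
      using finA dis by (intro card_UN_disjoint) auto
    finally show ?thesis .
  qed
  \<comment> \<open>The other necklaces and \<open>X\<close> cannot make up for a small necklace, so
    each path has nearly \<open>q\<close> edges, and two of them together have at least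
    \<open>q\<close>.\<close>
  have msize: "q \<le> m i + (C + L1)" if i: "i < s" for i
  proof -
    have "(\<Sum>j<s. card (A j)) = card (A i) + (\<Sum>j\<in>{..<s} - {i}. card (A j))"
      using i by (subst sum.remove[of _ i]) auto
    also have "\<dots> \<le> card (A i) + (\<Sum>j\<in>{..<s} - {i}. q * (k - 1))"
      using cA by (intro add_left_mono sum_mono) auto
    also have "\<dots> = card (A i) + (s - 1) * (q * (k - 1))" using i by simp
    finally have "s * (q * (k - 1)) \<le> C + (card (A i) + (s - 1) * (q * (k - 1)))"
      using q(2) total cX by linarith
    moreover have "s * (q * (k - 1)) = (s - 1) * (q * (k - 1)) + q * (k - 1)"
      using i by (cases s) auto
    ultimately have "q * (k - 1) \<le> C + card (A i)" by linarith
    also have "\<dots> \<le> C + (m i * (k - 1) + L1)"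
      using necklace_card(2)[OF N1(1)[OF i]] N1(3)[OF i] unfolding A_def by linarith
    finally have *: "q * (k - 1) \<le> m i * (k - 1) + (C + L1)" by linarith
    show ?thesis
    proof (rule ccontr)
      assume "\<not> q \<le> m i + (C + L1)"
      then have "(m i + (C + L1) + 1) * (k - 1) \<le> q * (k - 1)" by (intro mult_le_mono) auto
      moreover have "(C + L1) * 1 \<le> (C + L1) * (k - 1)" using k_ge_3 by (intro mult_le_mono) auto
      ultimately show False using * k_ge_3 by (simp add: add_mult_distrib)
    qed
  qed
  have msum: "q \<le> m i + m j" if "i < s" "j < s" for i j
    using msize[OF that(1)] msize[OF that(2)] q(1) by (simp only: mult_2)
  \<comment> \<open>Minimality of the uncovered set forbids every absorption that takes in a vertex
    of \<open>X\<close>.\<close>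
  have absorb: False
    if i: "i < s" and new: "necklace R' a' P' b' m'" "R' \<union> P' = A i \<union> F" "R' \<subseteq> R i" "card (R i) \<le> card R' + 3 * k"
      and F: "F \<subseteq> A i \<union> X" "F \<inter> X \<noteq> {}" for i R' a' P' b' m' F
  proof -
    have new2: "R' \<union> P' = R i \<union> P i \<union> F" using new(2) by (simp add: A_def)
    have F1: "F \<subseteq> (R i \<union> P i) \<union> (\<Omega> - (\<Union>i<s. R i \<union> P i))" using F(1) by (simp add: A_def X0)
    have F2: "F \<inter> (\<Omega> - (\<Union>i<s. R i \<union> P i)) \<noteq> {}" using F(2) by (simp add: X0)
    from necklaces_absorb[OF fin N i new(1) new2 new(3,4) F1 F2] minimal
    show False by (meson linorder_not_less)
  qed

  \<comment> \<open>Removing \<open>Bad i\<close> ensures that every \<open>Y\<close> forming a red edge with a vertex of \<open>G i\<close>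
    does so with at least two vertices of \<open>S i\<close>; hence distinct end vertices
    are available for any two members of \<open>F i\<close>.\<close>
  define S where "S i = R i - {a i, b i}" for i
  define D where "D i Y = {v \<in> S i. red (insert v Y)}" for i Y
  define Bad where "Bad i = (\<Union>Y\<in>{Y \<in> Pow X. card (D i Y) \<le> 1}. D i Y)" for i
  define G where "G i = S i - Bad i" for i
  define F where "F i = {Y. Y \<subseteq> X \<and> card Y = k - 1 \<and> 2 \<le> card (D i Y)}" for i
  have SP: "S i \<inter> P i = {}" if "i < s" for i using PR[OF that] by (auto simp: S_def)
  have SA: "S i \<subseteq> A i" "S i \<subseteq> R i" for i by (auto simp: S_def A_def)
  have finS: "finite (S i)" if "i < s" for i using finA[OF that] SA(1) finite_subset by blast
  have XR: "X \<inter> R i = {}" "X \<inter> P i = {}" if "i < s" for i using XA[OF that] by (auto simp: A_def)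
  have cG: "K \<le> card (G i)" if i: "i < s" for i
  proof -
    have "card (Bad i) \<le> (\<Sum>Y\<in>{Y \<in> Pow X. card (D i Y) \<le> 1}. card (D i Y))"
      unfolding Bad_def using finX by (intro card_UN_le) auto
    also have "\<dots> \<le> (\<Sum>Y\<in>{Y \<in> Pow X. card (D i Y) \<le> 1}. 1)" by (intro sum_mono) auto
    also have "\<dots> \<le> card (Pow X)" using finX by (auto intro: card_mono)
    also have "\<dots> \<le> 2 ^ C" using finX cX by (simp add: card_Pow)
    finally have "card (Bad i) \<le> 2 ^ C" .
    moreover have "finite (Bad i)" using finX finS[OF i] by (auto simp: Bad_def D_def)
    then have "card (S i) - card (Bad i) \<le> card (G i)" unfolding G_def by (intro diff_card_le_card_Diff)
    moreover have "card (R i) - card {a i, b i} \<le> card (S i)" unfolding S_def by (intro diff_card_le_card_Diff) simp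
    moreover have "card {a i, b i} \<le> 2" by (simp add: card_insert_if)
    ultimately show ?thesis using N1(4)[OF i] J by linarith
  qed
  \<comment> \<open>Such an edge would join two necklaces whose paths already have at least
    \<open>q\<close> edges between them.\<close>
  have link: False if e: "red e" "card e = k" "e \<subseteq> X \<union> (\<Union>i<s. S i)" "v \<in> e \<inter> S i" "w \<in> e \<inter> S j"
    and ij: "i < s" "j < s" "i \<noteq> j" for e v w i j
  proof -
    have eP: "e \<inter> P l = {}" if l: "l < s" for l
    proof -
      have "S l' \<inter> P l = {}" if "l' < s" for l'
        using SP[OF l] dis[OF that l] SA(1)[of l'] by (cases "l' = l") (auto simp: A_def)
      then show ?thesis using e(3) XR(2)[OF l] by blast
    qed
    have vw: "v \<in> e \<inter> R i" "w \<in> e \<inter> R j" using e(4,5) SA(2) by blast+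
    obtain Q where Q: "lpath (a i) Q (a j) (m i + m j + 3)" "Q \<subseteq> (R i \<union> P i) \<union> (R j \<union> P j) \<union> e"
      by (rule necklaces_link_edge[OF N1(1)[OF ij(1)] N1(1)[OF ij(2)] big2[OF ij(1)] big2[OF ij(2)]
          dis[OF ij, unfolded A_def] e(1,2) eP[OF ij(1)] eP[OF ij(2)] vw])
    have "S l \<subseteq> \<Omega>" if "l < s" for l using SA(1)[of l] N1(2)[OF that] by (rule order_trans)
    then have "(\<Union>i<s. S i) \<subseteq> \<Omega>" by (simp add: UN_subset_iff)
    then have "e \<subseteq> \<Omega>" using e(3) XO by blast
    then have "Q \<subseteq> \<Omega>" using Q(2) AO[OF ij(1)] AO[OF ij(2)] by blast
    from no_long[OF Q(1) this] show False using msum[OF ij(1,2)] by linarith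
  qed
  have Dv: "red (insert v Y)" "card (insert v Y) = k" "insert v Y \<inter> P i = {}" "insert v Y \<inter> R i = {v}"
    if "i < s" "Y \<subseteq> X" "card Y = k - 1" "v \<in> D i Y" for i v Y
  proof -
    have v: "v \<in> S i" using that(4) by (simp add: D_def)
    show "red (insert v Y)" using that(4) by (simp add: D_def)
    show "insert v Y \<inter> P i = {}" using v SP[OF that(1)] XR(2)[OF that(1)] that(2) by blast
    show "insert v Y \<inter> R i = {v}" using v SA(2) XR(1)[OF that(1)] that(2) by blast
    have "v \<notin> Y" using v SA(2) XR(1)[OF that(1)] that(2) by blast
    then show "card (insert v Y) = k" using that finX finite_subset k_ge_3 by (subst card_insert_disjoint) auto
  qed
  have two_ends: "\<exists>v w. v \<in> D i Y \<and> w \<in> D j Y' \<and> v \<noteq> w" if "Y \<in> F i" "Y' \<in> F j" for i j Y Y'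
  proof -
    have "2 \<le> card (D i Y)" "2 \<le> card (D j Y')" using that by (auto simp: F_def)
    then obtain v where v: "v \<in> D i Y" by fastforce
    have "card (D j Y' - {v}) \<noteq> 0" using \<open>2 \<le> card (D j Y')\<close> by (simp add: card_Diff_singleton_if)
    then have "D j Y' - {v} \<noteq> {}" by (metis card.empty)
    then show ?thesis using v by blast
  qed
  \<comment> \<open>In one necklace, the edges \<open>insert v Y\<close> and
    \<open>insert w Y'\<close> would be absorbed; in different necklaces they would link them. So
    the intersection condition in \<open>tau\<close> holds for the union of all
    \<open>F i\<close>.\<close>
  have F_meet: "card (Y \<inter> Y') \<noteq> 1" if Y: "Y \<in> F i" "Y' \<in> F j" and ij: "i < s" "j < s" for Y Y' i j
  proof
    assume "card (Y \<inter> Y') = 1"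
    then obtain y where y: "Y \<inter> Y' = {y}" using card_1_singletonE by blast
    obtain v w where vw: "v \<in> D i Y" "w \<in> D j Y'" "v \<noteq> w" using two_ends[OF Y] by blast
    have YF: "Y \<subseteq> X" "card Y = k - 1" "Y' \<subseteq> X" "card Y' = k - 1" using Y by (auto simp: F_def)
    note dv = Dv[OF ij(1) YF(1,2) vw(1)] and dw = Dv[OF ij(2) YF(3,4) vw(2)]
    have vS: "v \<in> A i" "w \<in> A j" using vw SA(1) by (auto simp: D_def)
    then have vX: "v \<notin> X" "w \<notin> X" using XA ij by blast+
    have ef: "insert v Y \<inter> insert w Y' = {y}" using y vX YF vw(3) by auto
    show False
    proof (cases "i = j")
      case True
      obtain R' P' c m' where new: "necklace R' (a i) P' c m'" "R' \<union> P' = R i \<union> P i \<union> (insert v Y \<union> insert w Y')"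
        "R' \<subseteq> R i" "card (R i) \<le> card R' + 3 * k"
        by (rule necklace_absorb_two_edges[OF N1(1)[OF ij(1)] big[OF ij(1)] dv dw[folded True] ef vw(3)])
      have "insert v Y \<union> insert w Y' \<subseteq> A i \<union> X" using vS YF True by blast
      moreover have "(insert v Y \<union> insert w Y') \<inter> X \<noteq> {}" using y YF by blast
      ultimately show False using absorb[OF ij(1) new(1) _ new(3,4)] new(2) unfolding A_def by blast
    next
      case False
      have e2: "insert v Y \<inter> (R j \<union> P j) = {}"
        using vS(1) dis[OF ij False] XA[OF ij(2)] YF(1) unfolding A_def by blast
      have f2: "insert w Y' \<inter> (R i \<union> P i) = {}"
        using vS(2) dis[OF ij False] XA[OF ij(1)] YF(3) unfolding A_def by blast
      have hit: "v \<in> insert v Y \<inter> R i" "w \<in> insert w Y' \<inter> R j" using dv(4) dw(4) by blast+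
      obtain Q where Q: "lpath (a i) Q (a j) (m i + m j + 4)"
        "Q \<subseteq> (R i \<union> P i) \<union> (R j \<union> P j) \<union> (insert v Y \<union> insert w Y')"
        by (rule necklaces_link_two_edges[OF N1(1)[OF ij(1)] N1(1)[OF ij(2)] big2[OF ij(1)] big2[OF ij(2)]
            dis[OF ij False, unfolded A_def] dv(1-3) e2 hit(1) dw(1-3) f2 hit(2) ef])
      have "insert v Y \<union> insert w Y' \<subseteq> \<Omega>"
        using vS YF(1,3) XO N1(2)[OF ij(1)] N1(2)[OF ij(2)] by blast
      then have "Q \<subseteq> \<Omega>" using Q(2) AO[OF ij(1)] AO[OF ij(2)] by blast
      from no_long[OF Q(1) this] show False using msum[OF ij(1,2)] by linarith
    qed
  qed
  \<comment> \<open>Such a \<open>Z\<close> is the last part next to the cliques \<open>G i\<close>: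
    a red edge across would allow a link or an absorption, or would put a subset of \<open>Z\<close>
    into some \<open>F i\<close>.\<close>
  have indep: "card Z < \<sigma>" if Z: "Z \<subseteq> X" "\<And>i Y. i < s \<Longrightarrow> Y \<in> F i \<Longrightarrow> \<not> Y \<subseteq> Z" for Z
  proof -
    let ?B = "G(s := Z)"
    have GA: "G i \<subseteq> A i" "G i \<subseteq> S i" "G i \<subseteq> R i" for i using SA by (auto simp: G_def)
    have "blue_parts ?B (Suc s)"
      unfolding blue_parts_def
    proof (intro conjI allI impI notI)
      fix i j assume ij: "i < Suc s" "j < Suc s" "i \<noteq> j"
      have 1: "G l \<inter> Z = {}" if "l < s" for l using GA(1)[of l] XA[OF that] Z(1) by blast
      have 2: "G l \<inter> G l' = {}" if "l < s" "l' < s" "l \<noteq> l'" for l l'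
        using GA(1)[of l] GA(1)[of l'] dis[OF that] by blast
      show "?B i \<inter> ?B j = {}"
        using ij 1 2 by (cases "i = s"; cases "j = s") (simp_all add: Int_commute)
    next
      fix e assume e: "e \<subseteq> (\<Union>i<Suc s. ?B i)" "card e = k" "\<forall>i<Suc s. \<not> e \<subseteq> ?B i" "red e"
      have "{..<s} \<inter> {x. x \<noteq> s} = {..<s}" by auto
      then have "(\<Union>i<Suc s. ?B i) = (\<Union>i<s. G i) \<union> Z" by (simp add: lessThan_Suc Un_commute)
      then have sub: "e \<subseteq> (\<Union>i<s. G i) \<union> Z" using e(1) by simp
      have "\<not> e \<subseteq> Z" using e(3)[rule_format, of s] by simp
      then obtain v i where vi: "v \<in> e" "i < s" "v \<in> G i" using sub by blast
      have eS: "e \<subseteq> X \<union> (\<Union>i<s. S i)" using sub GA(2) Z(1) by blast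
      have only: "e \<subseteq> G i \<union> Z"
      proof
        fix w assume w: "w \<in> e"
        show "w \<in> G i \<union> Z"
        proof (rule ccontr)
          assume "w \<notin> G i \<union> Z"
          then obtain j where "j < s" "w \<in> G j" "j \<noteq> i" using sub w by blast
          then show False using link[OF e(4,2) eS _ _ vi(2), of v w j] vi w GA(2) by blast
        qed
      qed
      have "\<not> e \<subseteq> G i" using e(3)[rule_format, of i] vi(2) by simp
      then have eX: "e \<inter> X \<noteq> {}" using only Z(1) by blast
      have eP: "e \<inter> P i = {}" using only GA(2)[of i] SP[OF vi(2)] XR(2)[OF vi(2)] Z(1) by blast
      show False
      proof (cases "\<exists>w. w \<in> e \<inter> G i \<and> w \<noteq> v")
        case True
        then obtain w where w: "w \<in> e \<inter> G i" "v \<noteq> w" by blast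
        have hit: "v \<in> e \<inter> R i" "w \<in> e \<inter> R i" using vi w GA(3) by blast+
        obtain R' P' c m' where new: "necklace R' (a i) P' c m'" "R' \<union> P' = R i \<union> P i \<union> e"
          "R' \<subseteq> R i" "card (R i) \<le> card R' + 3 * k"
          by (rule necklace_absorb_edge[OF N1(1)[OF vi(2)] big2[OF vi(2)] e(4,2) eP hit w(2)])
        have "e \<subseteq> A i \<union> X" using only GA(1) Z(1) by blast
        then show False using absorb[OF vi(2) new(1) _ new(3,4)] new(2) eX unfolding A_def by blast
      next
        case False
        define Y where "Y = e - {v}"
        have YZ: "Y \<subseteq> Z" using False only by (auto simp: Y_def)
        have iv: "insert v Y = e" using vi(1) by (auto simp: Y_def)
        have cY: "card Y = k - 1" using vi(1) e(2) by (simp add: Y_def)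
        have "v \<in> D i Y" using vi(3) GA(2) e(4) iv by (auto simp: D_def)
        moreover have "Y \<in> Pow X" using YZ Z(1) by blast
        moreover have "v \<notin> Bad i" using vi(3) by (simp add: G_def)
        ultimately have "\<not> card (D i Y) \<le> 1" unfolding Bad_def by blast
        then have "Y \<in> F i" using cY YZ Z(1) by (auto simp: F_def)
        then show False using Z(2)[OF vi(2)] YZ by blast
      qed
    qed
    moreover have "\<forall>i\<le>s. ?B i \<subseteq> \<Omega>"
    proof (intro allI impI)
      fix i assume "i \<le> s"
      then show "?B i \<subseteq> \<Omega>"
        using order_trans[OF GA(1) N1(2), of i] order_trans[OF Z(1) XO] by (cases "i = s") simp_all
    qed
    moreover have "\<forall>i<s. K \<le> card (?B i)" using cG by simp
    ultimately have "card (?B s) < \<sigma>" by (rule no_blue)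
    then show ?thesis by simp
  qed
  show ?thesis
  proof (cases "\<exists>i<s. \<exists>Y\<in>F i. \<exists>Y'\<in>F i. Y \<inter> Y' = {}")
    case True
    then obtain i Y Y' where i: "i < s" and Y: "Y \<in> F i" "Y' \<in> F i" and YY: "Y \<inter> Y' = {}" by blast
    obtain v w where vw: "v \<in> D i Y" "w \<in> D i Y'" "v \<noteq> w" using two_ends[OF Y] by blast
    have YF: "Y \<subseteq> X" "card Y = k - 1" "Y' \<subseteq> X" "card Y' = k - 1" using Y by (auto simp: F_def)
    note dv = Dv[OF i YF(1,2) vw(1)] and dw = Dv[OF i YF(3,4) vw(2)]
    have vS: "v \<in> A i" "w \<in> A i" using vw SA(1) by (auto simp: D_def)
    then have vX: "v \<notin> X" "w \<notin> X" using XA i by blast+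
    have ef: "insert v Y \<inter> insert w Y' = {}" using YY vX YF vw(3) by auto
    have small: "card (A i) + 2 * (k - 1) \<le> q * (k - 1)"
    proof (rule ccontr)
      assume "\<not> card (A i) + 2 * (k - 1) \<le> q * (k - 1)"
      then have "q * (k - 1) + 1 \<le> card (R i \<union> P i) + 2 * (k - 1)" by (simp add: A_def)
      from necklace_path_two_ends[OF N1(1)[OF i] big[OF i] this dv dw ef]
      obtain x Q y where Q: "lpath x Q y q" "Q \<subseteq> R i \<union> P i \<union> (insert v Y \<union> insert w Y')" by blast
      have "insert v Y \<union> insert w Y' \<subseteq> \<Omega>" using vS YF(1,3) XO N1(2)[OF i] by blast
      then have "Q \<subseteq> \<Omega>" using Q(2) AO[OF i] by blast
      then show False using no_path[OF Q(1)] by blast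
    qed
    have "card X \<le> \<tau>"
    proof (rule ccontr)
      assume "\<not> card X \<le> \<tau>"
      then have lt: "\<tau> < card X" by simp
      have f1: "\<forall>f\<in>(\<Union>i<s. F i). f \<subseteq> X \<and> card f = k - 1" by (auto simp: F_def)
      have f2: "\<forall>f\<in>(\<Union>i<s. F i). \<forall>g\<in>(\<Union>i<s. F i). f \<noteq> g \<longrightarrow> card (f \<inter> g) \<noteq> 1" using F_meet by blast
      obtain Z where Z: "Z \<subseteq> X" "\<sigma> \<le> card Z" "\<forall>f\<in>(\<Union>i<s. F i). \<not> f \<subseteq> Z" using tau[OF XO lt f1 f2] by blast
      have "card Z < \<sigma>" using indep[OF Z(1)] Z(3) by blast
      then show False using Z(2) by simp
    qed
    moreover have "(\<Sum>j<s. card (A j)) + 2 * (k - 1) \<le> s * (q * (k - 1))"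
    proof -
      have "(\<Sum>j<s. card (A j)) + 2 * (k - 1) = card (A i) + 2 * (k - 1) + (\<Sum>j\<in>{..<s} - {i}. card (A j))"
        using i by (subst sum.remove[of _ i]) auto
      also have "\<dots> \<le> q * (k - 1) + (\<Sum>j\<in>{..<s} - {i}. q * (k - 1))"
        using cA small by (intro add_mono sum_mono) auto
      also have "\<dots> = s * (q * (k - 1))" using i by (cases s) auto
      finally show ?thesis .
    qed
    ultimately have "card \<Omega> + 2 * (k - 1) \<le> s * (q * (k - 1)) + \<tau>" using total by linarith
    then show ?thesis by blast
  next
    case False
    have "\<exists>h. h \<subseteq> X \<and> card h + card (A i) \<le> q * (k - 1) \<and> (\<forall>Y\<in>F i. Y \<inter> h \<noteq> {})" if i: "i < s" for i
    proof (cases "F i = {}")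
      case True
      then show ?thesis using cA[OF i] by (intro exI[of _ "{}"]) auto
    next
      case f: False
      then obtain Y where Y: "Y \<in> F i" by blast
      have YF: "Y \<subseteq> X" "card Y = k - 1" "2 \<le> card (D i Y)" using Y by (auto simp: F_def)
      obtain v where v: "v \<in> D i Y" using YF(3) by fastforce
      obtain y where y: "y \<in> Y" using YF(2) k_ge_3 by fastforce
      have finY: "finite Y" using YF(1) finX finite_subset by blast
      have "card (A i) + (k - 1) \<le> q * (k - 1)"
      proof (rule ccontr)
        assume "\<not> card (A i) + (k - 1) \<le> q * (k - 1)"
        then have "q * (k - 1) + 1 \<le> card (R i \<union> P i) + (k - 1)" by (simp add: A_def)
        from necklace_path_one_end[OF N1(1)[OF i] big2[OF i] this Dv[OF i YF(1,2) v]]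
        obtain x Q z where Q: "lpath x Q z q" "Q \<subseteq> R i \<union> P i \<union> insert v Y" by blast
        have "v \<in> A i" using v SA(1) by (auto simp: D_def)
        then have "insert v Y \<subseteq> \<Omega>" using YF(1) XO N1(2)[OF i] by blast
        then have "Q \<subseteq> \<Omega>" using Q(2) AO[OF i] by blast
        then show False using no_path[OF Q(1)] by blast
      qed
      then have "card (Y - {y}) + card (A i) \<le> q * (k - 1)" using YF(2) y finY by simp
      \<comment> \<open>\<open>Y'\<close> meets \<open>Y\<close>, and by \<open>F_meet\<close> not
        in a single vertex, so it also meets \<open>Y\<close> outside \<open>y\<close>. The hitting
        set thus has only \<open>k - 2\<close> vertices.\<close>
      moreover have "Y' \<inter> (Y - {y}) \<noteq> {}" if Y': "Y' \<in> F i" for Y'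
      proof
        assume "Y' \<inter> (Y - {y}) = {}"
        moreover have "Y' \<inter> Y \<noteq> {}" using False i Y Y' by blast
        ultimately have "Y' \<inter> Y = {y}" by blast
        then show False using F_meet[OF Y' Y i i] by simp
      qed
      ultimately show ?thesis using YF(1) by (intro exI[of _ "Y - {y}"]) auto
    qed
    then obtain h where h: "\<And>i. i < s \<Longrightarrow> h i \<subseteq> X" "\<And>i. i < s \<Longrightarrow> card (h i) + card (A i) \<le> q * (k - 1)"
      "\<And>i Y. i < s \<Longrightarrow> Y \<in> F i \<Longrightarrow> Y \<inter> h i \<noteq> {}" by metis
    \<comment> \<open>Each \<open>h i\<close> is paid for by the shortfall of its necklace, so
      deleting all of them costs nothing in the count, while the rest of \<open>X\<close> contains
      no member of any \<open>F i\<close>.\<close>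
    define Z where "Z = X - (\<Union>i<s. h i)"
    have "card Z < \<sigma>"
    proof (rule indep)
      show "Z \<subseteq> X" by (auto simp: Z_def)
      show "\<not> Y \<subseteq> Z" if "i < s" "Y \<in> F i" for i Y using h(3)[OF that] that(1) unfolding Z_def by blast
    qed
    moreover have "card X \<le> card Z + (\<Sum>i<s. card (h i))"
    proof -
      have "finite (\<Union>i<s. h i)" using h(1) finX finite_subset by blast
      then have "card X - card (\<Union>i<s. h i) \<le> card Z" unfolding Z_def by (intro diff_card_le_card_Diff)
      moreover have "card (\<Union>i<s. h i) \<le> (\<Sum>i<s. card (h i))" by (rule card_UN_le) simp
      ultimately show ?thesis by linarith
    qed
    moreover have "(\<Sum>i<s. card (h i)) + (\<Sum>i<s. card (A i)) \<le> s * (q * (k - 1))"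
    proof -
      have "(\<Sum>i<s. card (h i) + card (A i)) \<le> (\<Sum>i<s. q * (k - 1))" using h(2) by (intro sum_mono) auto
      then show ?thesis by (simp add: sum.distrib)
    qed
    ultimately have "card \<Omega> < s * (q * (k - 1)) + \<sigma>" using total by linarith
    then show ?thesis by blast
  qed
qed

end

subsection \<open>Ramsey numbers\<close>

text \<open>The partition theorem for \<open>{..<M}\<close> is carried along a bijection to an
  arbitrary finite set with at least \<open>M\<close> elements; colour \<open>0\<close> stands for
  \<open>c\<close>.\<close>

lemma ramsey_uniform:
  "\<exists>M. \<forall>(U :: 'b set) c. finite U \<longrightarrow> M \<le> card U \<longrightarrow>
     (\<exists>C\<subseteq>U. card C = l \<and> (\<forall>e\<subseteq>C. card e = j \<longrightarrow> c e)) \<or>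
     (\<exists>C\<subseteq>U. card C = t \<and> (\<forall>e\<subseteq>C. card e = j \<longrightarrow> \<not> c e))"
proof -
  obtain M :: nat where M: "partn_lst {..<M} [l, t] j" using ramsey_full by blast
  show ?thesis
  proof (intro exI[of _ M] allI impI)
    fix U :: "'b set" and c :: "'b set \<Rightarrow> bool" assume U: "finite U" "M \<le> card U"
    obtain U' where U': "U' \<subseteq> U" "card U' = M" "finite U'" using U obtain_subset_with_card_n by metis
    obtain g where g: "bij_betw g {..<M} U'"
      using finite_same_card_bij[of "{..<M}" U'] U' by auto
    define f where "f e = (if c (g ` e) then 0 else 1 :: nat)" for e
    have "f \<in> nsets {..<M} j \<rightarrow> {..<2}" by (auto simp: f_def)
    then obtain i H where i: "i < length [l, t]" and H: "H \<in> nsets {..<M} ([l, t] ! i)"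
      and fi: "f ` nsets H j \<subseteq> {i}"
      by (rule partn_lstE[OF M]) simp
    have H': "H \<subseteq> {..<M}" "card H = [l, t] ! i" "finite H" using H by (auto simp: nsets_def)
    have inj: "inj_on g H" using g H'(1) by (auto simp: bij_betw_def intro: inj_on_subset)
    have gH: "g ` H \<subseteq> U" "card (g ` H) = [l, t] ! i"
      using g H' U' card_image[OF inj] by (auto simp: bij_betw_def)
    have col: "c e \<longleftrightarrow> i = 0" if e: "e \<subseteq> g ` H" "card e = j" for e
    proof -
      obtain e' where e': "e' \<subseteq> H" "e = g ` e'" using e(1) by (auto simp: subset_image_iff)
      have "card e' = j" using e' e(2) inj by (metis card_image inj_on_subset)
      then have "e' \<in> nsets H j" using e'(1) H'(3) by (auto simp: nsets_def intro: finite_subset)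
      then have "f e' = i" using fi by blast
      then show ?thesis using e'(2) i by (auto simp: f_def split: if_splits)
    qed
    show "(\<exists>C\<subseteq>U. card C = l \<and> (\<forall>e\<subseteq>C. card e = j \<longrightarrow> c e)) \<or>
        (\<exists>C\<subseteq>U. card C = t \<and> (\<forall>e\<subseteq>C. card e = j \<longrightarrow> \<not> c e))"
    proof (cases "i = 0")
      case True
      then show ?thesis using gH col by (intro disjI1 exI[of _ "g ` H"]) auto
    next
      case False
      then have "i = 1" using i by simp
      then show ?thesis using gH col by (intro disjI2 exI[of _ "g ` H"]) auto
    qed
  qed
qed

section \<open>Independence numbers and the extremal function \<open>tau\<close>\<close>

lemma indep_num_ge:
  assumes "finite V" "S \<subseteq> V" "\<forall>e\<in>E. \<not> e \<subseteq> S"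
  shows "card S \<le> indep_num V E"
proof -
  have "{card S | S. S \<subseteq> V \<and> (\<forall>e\<in>E. \<not> e \<subseteq> S)} \<subseteq> card ` Pow V" by blast
  then have "finite {card S | S. S \<subseteq> V \<and> (\<forall>e\<in>E. \<not> e \<subseteq> S)}"
    using assms(1) finite_subset by blast
  then show ?thesis unfolding indep_num_def using assms by (intro Max_ge) auto
qed

lemma indep_num_attained:
  assumes "finite V" "\<forall>e\<in>E. e \<noteq> {}"
  obtains S where "S \<subseteq> V" "\<forall>e\<in>E. \<not> e \<subseteq> S" "card S = indep_num V E"
proof -
  let ?I = "{card S | S. S \<subseteq> V \<and> (\<forall>e\<in>E. \<not> e \<subseteq> S)}"
  have "?I \<subseteq> card ` Pow V" by blast
  then have "finite ?I" using assms(1) finite_subset by blast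
  moreover have "card ({} :: 'a set) \<in> ?I" using assms(2) by blast
  then have "?I \<noteq> {}" by blast
  ultimately have "indep_num V E \<in> ?I" unfolding indep_num_def by (rule Max_in)
  then show ?thesis using that by auto
qed

text \<open>The greatest \<open>N\<close> in the definition of \<open>tau\<close> is meaningful
  because the admissible \<open>N\<close> are bounded. As \<open>card X\<close> exceeds it,
  \<open>F\<close>, relabelled on \<open>{..<card X}\<close>, must fail the condition on the
  independence number.\<close>

lemma tau_independent_set:
  assumes j: "2 \<le> j" and X: "finite X" "tau j \<alpha> < card X"
    and F: "\<forall>f\<in>F. f \<subseteq> X \<and> card f = j"
    and meet: "\<forall>f\<in>F. \<forall>g\<in>F. f \<noteq> g \<longrightarrow> card (f \<inter> g) \<noteq> 1"
  shows "\<exists>Z\<subseteq>X. \<alpha> \<le> card Z \<and> (\<forall>f\<in>F. \<not> f \<subseteq> Z)"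
proof -
  define P where "P N \<longleftrightarrow> (\<exists>E :: nat set set. (\<forall>e\<in>E. e \<subseteq> {..<N} \<and> card e = j) \<and>
       indep_num {..<N} E < \<alpha> \<and>
       (\<forall>e1\<in>E. \<forall>e2\<in>E. e1 \<noteq> e2 \<longrightarrow> card (e1 \<inter> e2) \<noteq> 1))" for N
  have tau: "tau j \<alpha> = (GREATEST N. P N)" by (simp add: tau_def P_def)
  obtain M where M: "\<forall>(U :: nat set) c. finite U \<longrightarrow> M \<le> card U \<longrightarrow>
     (\<exists>C\<subseteq>U. card C = 2 * j - 1 \<and> (\<forall>e\<subseteq>C. card e = j \<longrightarrow> c e)) \<or>
     (\<exists>C\<subseteq>U. card C = \<alpha> \<and> (\<forall>e\<subseteq>C. card e = j \<longrightarrow> \<not> c e))"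
    using ramsey_uniform[of "2 * j - 1" j \<alpha>] ..
  \<comment> \<open>By Ramsey's theorem a large hypergraph without an independent set of size
    \<open>\<alpha>\<close> contains all \<open>j\<close>-subsets of some \<open>2 * j - 1\<close>
    vertices, and two of these meet in exactly one vertex.\<close>
  have bound: "N \<le> M" if PN: "P N" for N
  proof (rule ccontr)
    assume "\<not> N \<le> M"
    then have MN: "M \<le> card {..<N}" by simp
    obtain E :: "nat set set" where E: "\<forall>e\<in>E. e \<subseteq> {..<N} \<and> card e = j" "indep_num {..<N} E < \<alpha>"
      "\<forall>e1\<in>E. \<forall>e2\<in>E. e1 \<noteq> e2 \<longrightarrow> card (e1 \<inter> e2) \<noteq> 1"
      using PN unfolding P_def by (elim exE conjE) (rule that)
    from M[rule_format, OF finite_lessThan MN, of "\<lambda>e. e \<in> E"] show False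
    proof (elim disjE exE conjE)
      fix C assume C: "C \<subseteq> {..<N}" "card C = 2 * j - 1" "\<forall>e\<subseteq>C. card e = j \<longrightarrow> e \<in> E"
      have finC: "finite C" using C(1) finite_subset by blast
      have "j \<le> card C" using C(2) j by simp
      then obtain Y where Y: "Y \<subseteq> C" "card Y = j" using obtain_subset_with_card_n by metis
      obtain y where y: "y \<in> Y" using Y j by fastforce
      have finY: "finite Y" using Y finC finite_subset by blast
      have "card (insert y (C - Y)) = j"
        using y Y C(2) finC finY j by (simp add: card_Diff_subset)
      moreover have "insert y (C - Y) \<subseteq> C" using y Y by blast
      ultimately have "insert y (C - Y) \<in> E" "Y \<in> E" using C(3) Y by blast+
      moreover have int: "insert y (C - Y) \<inter> Y = {y}" using y by blast
      moreover have "insert y (C - Y) \<noteq> Y" using int Y(2) j by auto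
      ultimately show False using E(3) by (metis card.empty card_insert_disjoint empty_iff finite.emptyI One_nat_def)
    next
      fix C assume C: "C \<subseteq> {..<N}" "card C = \<alpha>" "\<forall>e\<subseteq>C. card e = j \<longrightarrow> e \<notin> E"
      have "card C \<le> indep_num {..<N} E" using C E(1) by (intro indep_num_ge) auto
      then show False using C(2) E(2) by simp
    qed
  qed
  have "\<not> P (card X)"
  proof
    assume "P (card X)"
    then have "card X \<le> tau j \<alpha>" unfolding tau using bound by (intro Greatest_le_nat) auto
    then show False using X(2) by simp
  qed
  obtain g where g: "bij_betw g {..<card X} X"
    using finite_same_card_bij[of "{..<card X}" X] X by auto
  define E where "E = {e. e \<subseteq> {..<card X} \<and> g ` e \<in> F}"
  have inj: "inj_on g e" if "e \<subseteq> {..<card X}" for e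
    using g that by (auto simp: bij_betw_def intro: inj_on_subset)
  have cE: "card e = j" if "e \<in> E" for e
    using that F card_image[OF inj[of e]] by (auto simp: E_def)
  have "card (e1 \<inter> e2) \<noteq> 1" if e: "e1 \<in> E" "e2 \<in> E" "e1 \<noteq> e2" for e1 e2
  proof -
    have sub: "e1 \<subseteq> {..<card X}" "e2 \<subseteq> {..<card X}" using e by (auto simp: E_def)
    have "g ` (e1 \<inter> e2) = g ` e1 \<inter> g ` e2"
      using inj_on_image_Int[OF inj[of "{..<card X}"] sub] by simp
    moreover have "g ` e1 \<noteq> g ` e2" using inj_on_image_eq_iff[OF inj[of "{..<card X}"] sub] e(3) by simp
    then have "card (g ` e1 \<inter> g ` e2) \<noteq> 1" using meet e(1,2) by (auto simp: E_def)
    moreover have "card (g ` (e1 \<inter> e2)) = card (e1 \<inter> e2)" using inj sub by (intro card_image) blast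
    ultimately show ?thesis by simp
  qed
  then have ge: "\<alpha> \<le> indep_num {..<card X} E"
    using \<open>\<not> P (card X)\<close> cE unfolding P_def E_def by (smt (verit) linorder_not_less mem_Collect_eq)
  have "\<forall>e\<in>E. e \<noteq> {}" using cE j by fastforce
  then obtain S where S: "S \<subseteq> {..<card X}" "\<forall>e\<in>E. \<not> e \<subseteq> S" "card S = indep_num {..<card X} E"
    using indep_num_attained[of "{..<card X}" E] by auto
  show ?thesis
  proof (intro exI[of _ "g ` S"] conjI ballI notI)
    show "g ` S \<subseteq> X" using S(1) g by (auto simp: bij_betw_def)
    show "\<alpha> \<le> card (g ` S)" using card_image[OF inj[OF S(1)]] S(3) ge by simp
    fix f assume f: "f \<in> F" "f \<subseteq> g ` S"
    then obtain e where e: "e \<subseteq> S" "f = g ` e" by (auto simp: subset_image_iff)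
    then have "e \<in> E" using f(1) S(1) by (auto simp: E_def)
    then show False using S(2) e(1) by blast
  qed
qed

section \<open>Optimal proper colourings of \<open>H\<close>\<close>

lemma chi_colouring:
  assumes "2 \<le> k" "kgraph k V E"
  shows "\<exists>c. proper_colouring V E c (chi V E)"
proof -
  have fin: "finite V" using assms by (simp add: kgraph_def)
  \<comment> \<open>Giving all vertices distinct colours is proper, as edges have at least two
    vertices; so the least number of colours exists.\<close>
  obtain c where c: "bij_betw c V {0..<card V}" using ex_bij_betw_finite_nat[OF fin] by blast
  have "proper_colouring V E c (card V)"
    unfolding proper_colouring_def
  proof (intro conjI ballI notI)
    fix v assume "v \<in> V" then show "c v < card V" using c by (auto simp: bij_betw_def)
  next
    fix e assume e: "e \<in> E" and mono: "\<exists>i. \<forall>v\<in>e. c v = i"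
    have e': "e \<subseteq> V" "card e = k" using assms e by (auto simp: kgraph_def)
    then have "inj_on c e" using c by (auto simp: bij_betw_def intro: inj_on_subset)
    then have "card e \<le> Suc 0" using mono finite_subset[OF e'(1) fin]
      by (subst card_le_Suc0_iff_eq) (auto simp: inj_on_def)
    then show False using e' assms(1) by simp
  qed
  then have "\<exists>m c. proper_colouring V E c m" by blast
  then show ?thesis unfolding chi_def by (rule LeastI_ex)
qed

text \<open>A vertex forces at least one colour, so the minimum defining \<open>sigma\<close> is
  taken over a nonempty set and attained by some class.\<close>

lemma sigma_colouring:
  assumes "2 \<le> k" "kgraph k V E" "V \<noteq> {}"
  obtains c i where "proper_colouring V E c (chi V E)" "i < chi V E" "card {v \<in> V. c v = i} = sigma V E"
proof -
  have "\<exists>s c. proper_colouring V E c (chi V E) \<and>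
       s = Min ((\<lambda>i. card {v\<in>V. c v = i}) ` {..<chi V E})"
    using chi_colouring[OF assms(1,2)] by blast
  from LeastI_ex[OF this] obtain c where c: "proper_colouring V E c (chi V E)"
    "sigma V E = Min ((\<lambda>i. card {v\<in>V. c v = i}) ` {..<chi V E})"
    unfolding sigma_def by blast
  have "0 < chi V E" using c(1) assms(3) by (fastforce simp: proper_colouring_def)
  then have "sigma V E \<in> (\<lambda>i. card {v\<in>V. c v = i}) ` {..<chi V E}"
    unfolding c(2) by (intro Min_in) auto
  then show ?thesis using that c(1) by auto
qed

section \<open>Red loose paths and blue copies of \<open>H\<close>\<close>

lemma has_red_loose_path:
  fixes col :: "nat set \<Rightarrow> bool"
  assumes k: "3 \<le> k" and P: "red_hypergraph.lpath k col a P b q" "P \<subseteq> {..<N}" and n: "n = q * (k - 1) + 1"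
  shows "has_copy N col True (loose_path_vertices n) (loose_path_edges k n)"
proof -
  interpret red_hypergraph k col by unfold_locales (rule k)
  obtain f where f: "bij_betw f {1..q * (k - 1) + 1} P"
    "\<And>i. 1 \<le> i \<Longrightarrow> i \<le> q \<Longrightarrow> col (f ` {(i - 1) * (k - 1) + 1 .. i * (k - 1) + 1})"
    using lpath_enumeration[OF P(1)] by blast
  have q: "(n - 1) div (k - 1) = q" using n k by simp
  show ?thesis
    unfolding has_copy_def loose_path_vertices_def loose_path_edges_def q
    using f P(2) unfolding n by (intro exI[of _ f]) (auto simp: bij_betw_def)
qed

lemma has_blue_copy_clique:
  assumes "kgraph k V E" "C \<subseteq> {..<N}" "card C = card V" "\<forall>e\<subseteq>C. card e = k \<longrightarrow> \<not> col e"
  shows "has_copy N col False V E"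
proof -
  have "finite V" "finite C" using assms(1,2) finite_subset by (auto simp: kgraph_def)
  then obtain f where f: "bij_betw f V C" using finite_same_card_bij assms(3) by metis
  have "\<not> col (f ` e)" if "e \<in> E" for e
  proof -
    have e: "e \<subseteq> V" "card e = k" using that assms(1) by (auto simp: kgraph_def)
    have "card (f ` e) = k" using f e by (metis bij_betw_def card_image inj_on_subset)
    moreover have "f ` e \<subseteq> C" using f e by (auto simp: bij_betw_def)
    ultimately show ?thesis using assms(4) by blast
  qed
  then show ?thesis unfolding has_copy_def using f assms(2) by (intro exI[of _ f]) (auto simp: bij_betw_def)
qed

text \<open>The class of colour \<open>i0\<close> goes into the last part, which alone may have
  fewer than \<open>card V\<close> vertices. An edge of \<open>H\<close> has at least two colours,
  so its image lies in no single part.\<close>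

lemma has_blue_copy_parts:
  assumes k: "3 \<le> k" and H: "kgraph k V E" "proper_colouring V E c (Suc s)" "i0 < Suc s"
    and B: "red_hypergraph.blue_parts k col B (Suc s)" "\<forall>i\<le>s. B i \<subseteq> {..<N}"
      "\<forall>i<s. card V \<le> card (B i)" "card {v \<in> V. c v = i0} \<le> card (B s)"
  shows "has_copy N col False V E"
proof -
  interpret red_hypergraph k col by unfold_locales (rule k)
  have finV: "finite V" using H by (simp add: kgraph_def)
  \<comment> \<open>The transposition of \<open>i0\<close> and \<open>s\<close> directs the chosen
    class to the last part; it is its own inverse.\<close>
  define \<pi> where "\<pi> i = (if i = i0 then s else if i = s then i0 else i)" for i
  have pp: "\<pi> (\<pi> i) = i" for i by (auto simp: \<pi>_def)
  have ps: "\<pi> i < Suc s" if "i < Suc s" for i using that H(3) by (auto simp: \<pi>_def)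
  have finB: "finite (B i)" if "i < Suc s" for i using B(2)[rule_format, of i] that finite_subset[of "B i" "{..<N}"] by simp
  have cs: "c v < Suc s" if "v \<in> V" for v using H(2) that by (simp add: proper_colouring_def)
  have "\<exists>g. inj_on g {v \<in> V. c v = i} \<and> g ` {v \<in> V. c v = i} \<subseteq> B (\<pi> i)" if i: "i < Suc s" for i
  proof -
    have "card {v \<in> V. c v = i} \<le> card (B (\<pi> i))"
    proof (cases "i = i0")
      case True
      then show ?thesis using B(4) by (simp add: \<pi>_def)
    next
      case False
      then have "\<pi> i < s" using i H(3) by (auto simp: \<pi>_def)
      then have "card V \<le> card (B (\<pi> i))" using B(3) by blast
      then show ?thesis using card_mono[OF finV, of "{v \<in> V. c v = i}"] by auto
    qed
    then show ?thesis using card_le_inj[of "{v \<in> V. c v = i}" "B (\<pi> i)"] finV finB[OF ps[OF i]] by auto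
  qed
  then have "\<forall>i. \<exists>g. i < Suc s \<longrightarrow> inj_on g {v \<in> V. c v = i} \<and> g ` {v \<in> V. c v = i} \<subseteq> B (\<pi> i)"
    by simp
  from choice[OF this] obtain g where g: "\<And>i. i < Suc s \<Longrightarrow> inj_on (g i) {v \<in> V. c v = i}"
    "\<And>i. i < Suc s \<Longrightarrow> g i ` {v \<in> V. c v = i} \<subseteq> B (\<pi> i)" by blast
  define f where "f v = g (c v) v" for v
  have fB: "f v \<in> B (\<pi> (c v))" if "v \<in> V" for v
    using g(2)[OF cs[OF that]] that by (auto simp: f_def)
  have disj: "B i \<inter> B j = {}" if "i < Suc s" "j < Suc s" "i \<noteq> j" for i j
    using B(1) that unfolding blue_parts_def by blast
  have same: "c v = \<pi> j" if "v \<in> V" "f v \<in> B j" "j < Suc s" for v j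
  proof -
    have "\<pi> (c v) = j" using disj[OF ps[OF cs[OF that(1)]] that(3)] fB[OF that(1)] that(2) by blast
    then show ?thesis using pp by metis
  qed
  have inj: "inj_on f V"
  proof (rule inj_onI)
    fix v w assume vw: "v \<in> V" "w \<in> V" "f v = f w"
    have "c v = \<pi> (\<pi> (c w))" using same[OF vw(1) _ ps[OF cs[OF vw(2)]]] fB[OF vw(2)] vw(3) by simp
    then have "c v = c w" by (simp add: pp)
    then show "v = w" using g(1)[OF cs[OF vw(1)]] vw by (auto simp: f_def inj_on_def)
  qed
  have fN: "f ` V \<subseteq> {..<N}"
    using fB B(2) ps cs by (fastforce simp: less_Suc_eq_le)
  have "\<not> col (f ` e)" if e: "e \<in> E" for e
  proof -
    have eV: "e \<subseteq> V" "card e = k" using e H(1) by (auto simp: kgraph_def)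
    have "card (f ` e) = k" using inj eV by (metis card_image inj_on_subset)
    moreover have "f ` e \<subseteq> (\<Union>i<Suc s. B i)" using fB ps cs eV(1) by blast
    moreover have "\<not> f ` e \<subseteq> B j" if j: "j < Suc s" for j
    proof
      assume "f ` e \<subseteq> B j"
      then have "\<forall>v\<in>e. c v = \<pi> j" using same j eV(1) by blast
      then show False using H(2) e by (auto simp: proper_colouring_def)
    qed
    ultimately show ?thesis using B(1) unfolding blue_parts_def by blast
  qed
  then show ?thesis unfolding has_copy_def using inj fN by blast
qed

section \<open>Choice of constants and the bound for large \<open>n\<close>\<close>

theorem theorem1p7:
  fixes k :: nat and V :: "'a set" and E :: "'a set set"
  assumes "k \<ge> 3" and "kgraph k V E" and "V \<noteq> {}"
  shows "\<exists>n0. \<forall>n \<ge> n0. n mod (k - 1) = 1 \<longrightarrow>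
    int (ramsey (loose_path_vertices n) (loose_path_edges k n) V E)
      \<le> (int (chi V E) - 1) * (int n - 1)
         + max (int (tau (k - 1) (sigma V E)) - 2 * int k + 3) (int (sigma V E))"
proof -
  have k2: "2 \<le> k" using assms(1) by simp
  define K \<sigma> \<tau> where "K = card V" and "\<sigma> = sigma V E" and "\<tau> = tau (k - 1) \<sigma>"
  obtain c i0 where c: "proper_colouring V E c (chi V E)" "i0 < chi V E" "card {v \<in> V. c v = i0} = \<sigma>"
    using sigma_colouring[OF k2 assms(2,3)] unfolding \<sigma>_def by blast
  obtain s where s: "chi V E = Suc s" using c(2) by (cases "chi V E") auto
  have finV: "finite V" using assms(2) by (simp add: kgraph_def)
  have sK: "\<sigma> \<le> K" unfolding K_def c(3)[symmetric] using finV by (intro card_mono) auto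
  \<comment> \<open>Tails of this size keep at least \<open>K\<close> vertices after one is dropped,
    and leave room for rerouting edges.\<close>
  define L where "L = K + 1 + 2 * k"
  obtain M where M: "\<forall>(U :: nat set) col. finite U \<longrightarrow> M \<le> card U \<longrightarrow>
     (\<exists>C\<subseteq>U. card C = L + k \<and> (\<forall>e\<subseteq>C. card e = k \<longrightarrow> col e)) \<or>
     (\<exists>C\<subseteq>U. card C = K \<and> (\<forall>e\<subseteq>C. card e = k \<longrightarrow> \<not> col e))"
    using ramsey_uniform[of "L + k" k K] ..
  \<comment> \<open>The bound \<open>C\<close> on the number of uncovered vertices depends on the size \<open>L\<close> of the tails
    but not on the size \<open>L1\<close> of the necklace cliques, so \<open>L1\<close> may be chosen after \<open>C\<close>.\<close>
  define C where "C = s * (2 * L + M + k) + K"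
  define J where "J = K + 2 + 2 ^ C + 3 * k + 1"
  define L1 where "L1 = J + 3 * k * C"
  obtain M1 where M1: "\<forall>(U :: nat set) col. finite U \<longrightarrow> M1 \<le> card U \<longrightarrow>
     (\<exists>C\<subseteq>U. card C = L1 + 2 * L + 2 * k \<and> (\<forall>e\<subseteq>C. card e = k \<longrightarrow> col e)) \<or>
     (\<exists>C\<subseteq>U. card C = K \<and> (\<forall>e\<subseteq>C. card e = k \<longrightarrow> \<not> col e))"
    using ramsey_uniform[of "L1 + 2 * L + 2 * k" k K] ..
  \<comment> \<open>The first summands are the bound on \<open>q\<close> required by
    \<open>necklace_decomposition\<close> with deficit \<open>0\<close>, made strict by
    \<open>1\<close>; the last is the one required by \<open>card_bound\<close>.\<close>
  define q0 where "q0 = s * (2 * L + M + k) + (M1 + (2 * L + M + k) + L1 + K) + 1 + 2 * (C + L1)"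
  show ?thesis
  proof (intro exI[of _ "q0 * (k - 1) + 1"] allI impI)
    fix n assume n0: "q0 * (k - 1) + 1 \<le> n" and mod: "n mod (k - 1) = 1"
    define q where "q = n div (k - 1)"
    have n: "n = q * (k - 1) + 1" using mod div_mult_mod_eq[of n "k - 1"] unfolding q_def by simp
    have "q0 * (k - 1) \<le> q * (k - 1)" using n0 n by simp
    then have q: "q0 \<le> q" using assms(1) by simp
    \<comment> \<open>The maximum is nonnegative since \<open>\<sigma>\<close> is, so
      \<open>nat\<close> changes nothing.\<close>
    define N where "N = s * (q * (k - 1)) + nat (max (int \<tau> - 2 * int k + 3) (int \<sigma>))"
    have N1: "s * (q * (k - 1)) + \<sigma> \<le> N" by (simp add: N_def)
    \<comment> \<open>As \<open>- 2 * k + 3 = - 2 * (k - 1) + 1\<close>, the inequality is strict,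
      which excludes the second alternative of \<open>card_bound\<close>.\<close>
    have N2: "s * (q * (k - 1)) + \<tau> < N + 2 * (k - 1)" using assms(1) unfolding N_def by linarith
    have intN: "int N = (int (chi V E) - 1) * (int n - 1) + max (int \<tau> - 2 * int k + 3) (int \<sigma>)"
    proof -
      have "0 \<le> max (int \<tau> - 2 * int k + 3) (int \<sigma>)" by (simp add: le_max_iff_disj)
      then show ?thesis unfolding N_def s n by simp
    qed
    have "has_copy N col True (loose_path_vertices n) (loose_path_edges k n) \<or> has_copy N col False V E"
      for col :: "nat set \<Rightarrow> bool"
    proof (rule ccontr)
      assume "\<not> ?thesis"
      then have no_red: "\<not> has_copy N col True (loose_path_vertices n) (loose_path_edges k n)"
        and no_blue: "\<not> has_copy N col False V E" by blast+
      interpret red_hypergraph k col by unfold_locales (rule assms(1))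
      have no_path: "\<not> P \<subseteq> {..<N}" if "lpath a P b q" for a P b
        using has_red_loose_path[OF assms(1) that _ n] no_red by blast
      have parts: "card (B s) < \<sigma>"
        if "blue_parts B (Suc s)" "\<forall>i\<le>s. B i \<subseteq> {..<N}" "\<forall>i<s. K \<le> card (B i)" for B
      proof (rule ccontr)
        assume "\<not> card (B s) < \<sigma>"
        then have "card {v \<in> V. c v = i0} \<le> card (B s)" using c(3) by simp
        from has_blue_copy_parts[OF assms(1,2) c(1,2)[unfolded s] that(1,2) that(3)[unfolded K_def] this] no_blue
        show False by blast
      qed
      \<comment> \<open>The red outcome must occur, because a blue clique on \<open>K\<close>
        vertices would contain a blue copy of \<open>H\<close>.\<close>
      have clique: "\<exists>C\<subseteq>U. red_clique C \<and> card C = l"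
        if mono: "(\<exists>C\<subseteq>U. card C = l \<and> (\<forall>e\<subseteq>C. card e = k \<longrightarrow> col e)) \<or>
           (\<exists>C\<subseteq>U. card C = K \<and> (\<forall>e\<subseteq>C. card e = k \<longrightarrow> \<not> col e))" and UN: "U \<subseteq> {..<N}" for U l
      proof -
        have "\<not> (\<exists>C\<subseteq>U. card C = K \<and> (\<forall>e\<subseteq>C. card e = k \<longrightarrow> \<not> col e))"
        proof
          assume "\<exists>C\<subseteq>U. card C = K \<and> (\<forall>e\<subseteq>C. card e = k \<longrightarrow> \<not> col e)"
          then obtain C where C: "C \<subseteq> U" "card C = card V" "\<forall>e\<subseteq>C. card e = k \<longrightarrow> \<not> col e"
            unfolding K_def by blast
          show False using has_blue_copy_clique[OF assms(2) order_trans[OF C(1) UN] C(2,3)] no_blue by (rule notE[rotated])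
        qed
        then obtain C where "C \<subseteq> U" "card C = l" "\<forall>e\<subseteq>C. card e = k \<longrightarrow> col e" using mono by blast
        moreover have "finite C" using \<open>C \<subseteq> U\<close> UN by (meson finite_lessThan finite_subset)
        ultimately show ?thesis unfolding red_clique_def by blast
      qed
      have fU: "finite U" if "U \<subseteq> {..<N}" for U :: "nat set" using that by (rule finite_subset) simp
      have "(\<exists>B. blue_parts B (Suc s) \<and> (\<forall>i\<le>s. B i \<subseteq> {..<N} \<and> K \<le> card (B i)))
       \<or> (\<exists>R a P b m. (\<forall>i<s. necklace (R i) (a i) (P i) (b i) (m i) \<and> R i \<union> P i \<subseteq> {..<N} \<and> card (R i) = L1) \<and>
            (\<forall>i<s. \<forall>j<s. i \<noteq> j \<longrightarrow> (R i \<union> P i) \<inter> (R j \<union> P j) = {}) \<and>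
            card ({..<N} - (\<Union>i<s. R i \<union> P i)) \<le> s * (2 * L + M + k) + K)"
      proof (rule necklace_decomposition[where \<Omega> = "{..<N}" and M' = M1 and q = q and D = 0])
        show "\<exists>C\<subseteq>U. red_clique C \<and> card C = L + k" if "U \<subseteq> {..<N}" "M \<le> card U" for U
          using clique[OF M[rule_format, OF fU[OF that(1)] that(2)] that(1)] .
        show "\<exists>C\<subseteq>U. red_clique C \<and> card C = L1 + 2 * L + 2 * k" if "U \<subseteq> {..<N}" "M1 \<le> card U" for U
          using clique[OF M1[rule_format, OF fU[OF that(1)] that(2)] that(1)] .
        show "2 * k \<le> L" "K < L" by (simp_all add: L_def)
        show "k \<le> L1" by (simp add: L1_def J_def)
        show "s * (q * (k - 1)) \<le> card {..<N} + 0" using N1 by simp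
        show "0 + s * (2 * L + M + k) + (M1 + (2 * L + M + k) + L1 + K) < q" using q unfolding q0_def by linarith
      qed (use no_path in auto)
      then show False
      proof (elim disjE exE conjE)
        fix B assume B: "blue_parts B (Suc s)" "\<forall>i\<le>s. B i \<subseteq> {..<N} \<and> K \<le> card (B i)"
        then have "card (B s) < \<sigma>" by (intro parts) auto
        moreover have "K \<le> card (B s)" using B(2) by blast
        ultimately show False using sK by linarith
      next
        fix R a P b m
        assume R: "\<forall>i<s. necklace (R i) (a i) (P i) (b i) (m i) \<and> R i \<union> P i \<subseteq> {..<N} \<and> card (R i) = L1"
          "\<forall>i<s. \<forall>j<s. i \<noteq> j \<longrightarrow> (R i \<union> P i) \<inter> (R j \<union> P j) = {}"
          and left: "card ({..<N} - (\<Union>i<s. R i \<union> P i)) \<le> s * (2 * L + M + k) + K"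
        have left': "card ({..<N} - (\<Union>i<s. R i \<union> P i)) \<le> C" using left by (simp only: C_def)
        then have "J + 3 * k * card ({..<N} - (\<Union>i<s. R i \<union> P i)) \<le> L1"
          unfolding L1_def by (intro add_left_mono mult_le_mono) auto
        then have "necklaces {..<N} J L1 s R a P b m"
          unfolding necklaces_def using R by simp
        from card_bound[OF _ this left', where K = K and q = q and \<sigma> = \<sigma> and \<tau> = \<tau>]
        have "card {..<N} < s * (q * (k - 1)) + \<sigma> \<or> card {..<N} + 2 * (k - 1) \<le> s * (q * (k - 1)) + \<tau>"
        proof
          show "K + 2 + 2 ^ C + 3 * k < J" by (simp add: J_def)
          show "2 * (C + L1) \<le> q" using q by (simp add: q0_def)
          show "s * (q * (k - 1)) \<le> card {..<N}" using N1 by simp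
          show "\<And>X F. X \<subseteq> {..<N} \<Longrightarrow> \<tau> < card X \<Longrightarrow> \<forall>f\<in>F. f \<subseteq> X \<and> card f = k - 1 \<Longrightarrow>
             \<forall>f\<in>F. \<forall>g\<in>F. f \<noteq> g \<longrightarrow> card (f \<inter> g) \<noteq> 1 \<Longrightarrow> \<exists>Z\<subseteq>X. \<sigma> \<le> card Z \<and> (\<forall>f\<in>F. \<not> f \<subseteq> Z)"
            using assms(1) fU unfolding \<tau>_def by (intro tau_independent_set) auto
        qed (use no_path parts in auto)
        then show False using N1 N2 by simp
      qed
    qed
    then have "ramsey (loose_path_vertices n) (loose_path_edges k n) V E \<le> N"
      unfolding ramsey_def by (intro Least_le) blast
    then show "int (ramsey (loose_path_vertices n) (loose_path_edges k n) V E)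
      \<le> (int (chi V E) - 1) * (int n - 1)
         + max (int (tau (k - 1) (sigma V E)) - 2 * int k + 3) (int (sigma V E))"
      using intN unfolding \<tau>_def \<sigma>_def by linarith
  qed
qed

end
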